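(* Let $B$ be a unital $C^*$-algebra and let $A\subseteq B$ be a dense and full $*$-subalgebra of $B$ (containing the identity of $B$). Suppose that $A$ is a unital Fréchet $Q$-algebra in its own topology and that $A$ is closed under $C^\infty$-functional calculus of self-adjoint elements. Then $Bsr(A)=Bsr(B)$.
   Context: All algebras are complex. A Fréchet algebra is a (locally convex) Fréchet space with an algebra structure whose multiplication is jointly continuous (it is not assumed $m$-convex). A unital topological algebra is a $Q$-algebra if its set of invertible elements is open. A subalgebra $A$ of $B$ (with the same identity) is full (spectral invariant) if every $a\in A$ that is invertible in $B$ is invertible in $A$. $A$ is closed under $C^\infty$-functional calculus of self-adjoint elements if for every self-adjoint $a\in A$ and every $C^\infty$ function $g$ on a neighborhood in $\mathbb R$ of the spectrum of $a$ in $B$, the element $g(a)\in B$ (continuous functional calculus in $B$) lies in $A$. For a unital algebra $A$, $Lg_n(A)$ is the set of $(a_1,\dots,a_n)\in A^n$ with $Aa_1+\cdots+Aa_n=A$. The Bass stable rank $Bsr(A)$ is the smallest positive integer $n$ such that for every $(a_1,\dots,a_{n+1})\in Lg_{n+1}(A)$ there is $(c_1,\dots,c_n)\in A^n$ with $(a_1+c_1a_{n+1},\dots,a_n+c_na_{n+1})\in Lg_n(A)$, or $\infty$ if no such $n$ exists. *)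

theory Defs
  imports "HOL-Analysis.Analysis" "HOL-Library.Extended_Nat"
begin

section \<open>Unital complex C*-algebras\<close>

text \<open>
  The unit comes from \<^class>\<open>monoid_mult\<close> rather than from \<^class>\<open>ring_1\<close>, so the zero algebra is
  not excluded.  In a nonzero algebra \<open>norm 1 = 1\<close> follows from the C*-identity.
\<close>

class unital_cstar_algebra = real_normed_algebra + banach + monoid_mult +
  fixes scaleC :: "complex \<Rightarrow> 'a \<Rightarrow> 'a" (infixr "*\<^sub>C" 75)
    and star :: "'a \<Rightarrow> 'a"
  assumes scaleC_add_right: "c *\<^sub>C (x + y) = c *\<^sub>C x + c *\<^sub>C y"
    and scaleC_add_left: "(c + d) *\<^sub>C x = c *\<^sub>C x + d *\<^sub>C x"
    and scaleC_scaleC: "c *\<^sub>C d *\<^sub>C x = (c * d) *\<^sub>C x"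
    and scaleR_eq_scaleC: "r *\<^sub>R x = complex_of_real r *\<^sub>C x"
    and mult_scaleC_left: "(c *\<^sub>C x) * y = c *\<^sub>C (x * y)"
    and mult_scaleC_right: "x * (c *\<^sub>C y) = c *\<^sub>C (x * y)"
    and norm_scaleC: "norm (c *\<^sub>C x) = cmod c * norm x"
    and star_add: "star (x + y) = star x + star y"
    and star_scaleC: "star (c *\<^sub>C x) = cnj c *\<^sub>C star x"
    and star_mult: "star (x * y) = star y * star x"
    and star_star: "star (star x) = x"
    and cstar_identity: "norm (star x * x) = (norm x)\<^sup>2"

section \<open>Subalgebras, invertibility, spectrum\<close>

definition unital_star_subalgebra :: "'b::unital_cstar_algebra set \<Rightarrow> bool" where
  "unital_star_subalgebra A \<longleftrightarrow>
     1 \<in> A \<and> (\<forall>x\<in>A. \<forall>y\<in>A. x + y \<in> A) \<and> (\<forall>c. \<forall>x\<in>A. c *\<^sub>C x \<in> A) \<and>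
     (\<forall>x\<in>A. \<forall>y\<in>A. x * y \<in> A) \<and> (\<forall>x\<in>A. star x \<in> A)"

definition invertibles :: "'b::monoid_mult set \<Rightarrow> 'b set" where
  "invertibles A = {x \<in> A. \<exists>y\<in>A. x * y = 1 \<and> y * x = 1}"

definition full_subalgebra :: "'b::unital_cstar_algebra set \<Rightarrow> bool" where
  "full_subalgebra A \<longleftrightarrow> (\<forall>a\<in>A. a \<in> invertibles UNIV \<longrightarrow> a \<in> invertibles A)"

definition spectrum :: "'b::unital_cstar_algebra \<Rightarrow> complex set" where
  "spectrum a = {z. z *\<^sub>C 1 - a \<notin> invertibles UNIV}"

section \<open>Functional calculus\<close>

text \<open>
  The continuous functional calculus of \<open>a\<close> is the unital *-homomorphism from \<open>C(spectrum a)\<close>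
  that sends the identity function to \<open>a\<close>.  Elements of \<open>C(spectrum a)\<close> are represented by
  functions on the whole plane which are continuous on the spectrum; the first condition says that
  only the values on the spectrum matter.
\<close>

definition is_continuous_calculus ::
    "'b::unital_cstar_algebra \<Rightarrow> ((complex \<Rightarrow> complex) \<Rightarrow> 'b) \<Rightarrow> bool" where
  "is_continuous_calculus a \<Phi> \<longleftrightarrow>
     (\<forall>f g. continuous_on (spectrum a) f \<and> (\<forall>z\<in>spectrum a. f z = g z) \<longrightarrow> \<Phi> f = \<Phi> g) \<and>
     (\<forall>f g. continuous_on (spectrum a) f \<and> continuous_on (spectrum a) g \<longrightarrow>
        \<Phi> (\<lambda>z. f z + g z) = \<Phi> f + \<Phi> g \<and> \<Phi> (\<lambda>z. f z * g z) = \<Phi> f * \<Phi> g) \<and>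
     (\<forall>c f. continuous_on (spectrum a) f \<longrightarrow>
        \<Phi> (\<lambda>z. c * f z) = c *\<^sub>C \<Phi> f \<and> \<Phi> (\<lambda>z. cnj (f z)) = star (\<Phi> f)) \<and>
     \<Phi> (\<lambda>z. 1) = 1 \<and> \<Phi> (\<lambda>z. z) = a"

text \<open>
  For normal \<open>a\<close> (in particular for self-adjoint \<open>a\<close>) such a homomorphism exists, and its values on
  functions continuous on the spectrum are uniquely determined, so the choice is immaterial there.
\<close>

definition continuous_calculus ::
    "'b::unital_cstar_algebra \<Rightarrow> (complex \<Rightarrow> complex) \<Rightarrow> 'b" where
  "continuous_calculus a = (SOME \<Phi>. is_continuous_calculus a \<Phi>)"

definition smooth_on_real :: "real set \<Rightarrow> (real \<Rightarrow> complex) \<Rightarrow> bool" where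
  "smooth_on_real U g \<longleftrightarrow>
     (\<exists>D :: nat \<Rightarrow> real \<Rightarrow> complex. D 0 = g \<and>
        (\<forall>k. \<forall>x\<in>U. (D k has_vector_derivative D (Suc k) x) (at x)))"

text \<open>
  The spectrum of a self-adjoint element is real, so \<open>\<lambda>z. g (Re z)\<close> is \<open>g\<close> on the spectrum.
\<close>

definition closed_under_smooth_calculus :: "'b::unital_cstar_algebra set \<Rightarrow> bool" where
  "closed_under_smooth_calculus A \<longleftrightarrow>
     (\<forall>a\<in>A. star a = a \<longrightarrow>
        (\<forall>U g. open U \<and> spectrum a \<subseteq> complex_of_real ` U \<and> smooth_on_real U g \<longrightarrow>
           continuous_calculus a (\<lambda>z. g (Re z)) \<in> A))"

section \<open>Frechet algebras\<close>

text \<open>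
  Below, \<open>T\<close> is a topology carried by the subspace \<open>A\<close>; it is not related to the norm topology.
\<close>

definition topological_vector_space_on ::
    "'b::unital_cstar_algebra set \<Rightarrow> 'b topology \<Rightarrow> bool" where
  "topological_vector_space_on A T \<longleftrightarrow>
     topspace T = A \<and>
     continuous_map (prod_topology T T) T (\<lambda>(x, y). x + y) \<and>
     continuous_map (prod_topology (euclidean :: complex topology) T) T (\<lambda>(c, x). c *\<^sub>C x)"

definition locally_convex_on :: "'b::unital_cstar_algebra topology \<Rightarrow> bool" where
  "locally_convex_on T \<longleftrightarrow>
     (\<forall>U. openin T U \<and> 0 \<in> U \<longrightarrow> (\<exists>V. openin T V \<and> 0 \<in> V \<and> convex V \<and> V \<subseteq> U))"

definition frechet_space_on :: "'b::unital_cstar_algebra set \<Rightarrow> 'b topology \<Rightarrow> bool" where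
  "frechet_space_on A T \<longleftrightarrow>
     topological_vector_space_on A T \<and> locally_convex_on T \<and>
     (\<exists>d. Metric_space A d \<and> Metric_space.mcomplete A d \<and> Metric_space.mtopology A d = T \<and>
          (\<forall>x\<in>A. \<forall>y\<in>A. \<forall>z\<in>A. d (x + z) (y + z) = d x y))"

definition frechet_algebra_on :: "'b::unital_cstar_algebra set \<Rightarrow> 'b topology \<Rightarrow> bool" where
  "frechet_algebra_on A T \<longleftrightarrow>
     frechet_space_on A T \<and> continuous_map (prod_topology T T) T (\<lambda>(x, y). x * y)"

definition Q_algebra_on :: "'b::unital_cstar_algebra set \<Rightarrow> 'b topology \<Rightarrow> bool" where
  "Q_algebra_on A T \<longleftrightarrow> openin T (invertibles A)"

section \<open>Bass stable rank\<close>

text \<open>An \<open>n\<close>-tuple is a function of which only the values at \<open>0, \<dots>, n - 1\<close> are used.\<close>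

definition Lg :: "nat \<Rightarrow> 'b::ring set \<Rightarrow> (nat \<Rightarrow> 'b) set" where
  "Lg n A = {a. (\<forall>i<n. a i \<in> A) \<and> {\<Sum>i<n. x i * a i |x. \<forall>i<n. x i \<in> A} = A}"

definition Bsr :: "'b::ring set \<Rightarrow> enat" where
  "Bsr A = Inf {enat n |n. n \<ge> 1 \<and>
     (\<forall>a \<in> Lg (Suc n) A. \<exists>c. (\<forall>i<n. c i \<in> A) \<and> (\<lambda>i. a i + c i * a n) \<in> Lg n A)}"

end

theory Submission
  imports Defs "HOL-Computational_Algebra.Fundamental_Theorem_Algebra"
begin

text \<open>
  Since \<open>A\<close> is full and dense, a tuple in \<open>A\<close> is left unimodular over \<open>A\<close> iff it is so over \<open>B\<close>, and
  left unimodularity over \<open>B\<close> survives small perturbations.  Hence a solution \<open>c\<close> of the stable rank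
  condition in \<open>B\<close> can be moved into \<open>A\<close>, which gives \<open>Bsr A \<le> Bsr B\<close>.

  For the converse, the argument of Herman and Vaserstein (\<open>tsr \<le> Bsr\<close> for C*-algebras) only needs
  \<open>f (x)\<close> for \<open>x = \<Sum> b\<^sub>i\<^sup>* b\<^sub>i\<close> and a smooth \<open>f\<close> supported near \<open>0\<close>, so it runs inside \<open>A\<close> and shows that
  \<open>Bsr A \<le> n\<close> makes the left unimodular \<open>n\<close>-tuples dense in \<open>B\<^sup>n\<close>.  Rieffel's inequality
  \<open>Bsr B \<le> tsr B\<close> then finishes the proof.
\<close>

section \<open>C*-algebra basics: inversion and spectrum\<close>

text \<open>The smoothness hypothesis speaks of \<open>continuous_calculus\<close>, a choice among
  homomorphisms, so it yields nothing until a calculus of a self-adjoint element is known to exist.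
  That calculus is built from polynomials, which rests on the norm of a self-adjoint element being
  bounded by its spectrum. The calculus in turn shows that elements \<open>star y * y\<close> are
  positive, hence that the spectrum of \<open>x\<close> is nonnegative, without which
  \<open>f (x)\<close> would not complete \<open>b\<close> to a unimodular tuple. The Bass condition
  in \<open>A\<close> is applied to a tuple whose last entry is \<open>f (x)\<close>, so this one
  value has to lie in \<open>A\<close>, and \<open>f\<close> is cut out of a flat exponential. The
  second function in the argument has to annihilate \<open>f (x)\<close> and to be close to
  \<open>1\<close> where \<open>x\<close> is large. Its value enters only the approximating tuple,
  which lives in \<open>B\<close>, so it can be a piecewise linear ramp.\<close>

lemma scaleC_one [simp]: "1 *\<^sub>C x = (x :: 'b::unital_cstar_algebra)"
  using scaleR_eq_scaleC[of 1 x] by simp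

lemma bounded_bilinear_scaleC:
  "bounded_bilinear (scaleC :: complex \<Rightarrow> 'b::unital_cstar_algebra \<Rightarrow> 'b)"
proof
  show "\<exists>K. \<forall>a (b::'b). norm (a *\<^sub>C b) \<le> norm a * norm b * K"
    by (rule exI[of _ 1]) (simp add: norm_scaleC)
qed (simp_all add: scaleC_add_left scaleC_add_right scaleR_eq_scaleC scaleC_scaleC
  scaleR_conv_of_real mult.commute)

interpretation scaleC: bounded_bilinear
  "scaleC :: complex \<Rightarrow> 'b::unital_cstar_algebra \<Rightarrow> 'b"
  by (rule bounded_bilinear_scaleC)

declare scaleC.zero_left [simp] scaleC.zero_right [simp]
declare scaleC_scaleC [simp] mult_scaleC_left [simp] mult_scaleC_right [simp] star_star [simp]

lemma norm_star [simp]: "norm (star x) = norm (x :: 'b::unital_cstar_algebra)"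
proof -
  have le: "norm y \<le> norm (star y)" for y :: 'b
  proof (cases "norm y = 0")
    case False
    have "norm y * norm y \<le> norm (star y) * norm y"
      using norm_mult_ineq[of "star y" y] by (simp add: cstar_identity power2_eq_square)
    then show ?thesis using False by (simp add: mult_le_cancel_right)
  qed simp
  show ?thesis using le[of x] le[of "star x"] by simp
qed

lemma bounded_linear_star: "bounded_linear (star :: 'b::unital_cstar_algebra \<Rightarrow> 'b)"
proof
  show "\<exists>K. \<forall>x::'b. norm (star x) \<le> norm x * K"
    by (rule exI[of _ 1]) simp
qed (simp_all add: star_add scaleR_eq_scaleC star_scaleC)

lemmas linear_star = bounded_linear.linear[OF bounded_linear_star]
lemmas star_zero [simp] = linear_0[OF linear_star]
lemmas star_diff = linear_diff[OF linear_star]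
lemmas star_sum = linear_sum[OF linear_star]
lemmas tendsto_star = bounded_linear.tendsto[OF bounded_linear_star]

lemma star_one [simp]: "star 1 = (1 :: 'b::unital_cstar_algebra)"
  by (metis mult_1_left star_mult star_star)

text \<open>An inequality rather than an equation, because the unit of the zero algebra has norm
  \<open>0\<close>.\<close>

lemma norm_one_le: "norm (1 :: 'b::unital_cstar_algebra) \<le> 1"
proof -
  have "norm (1::'b) = (norm (1::'b))\<^sup>2"
    using cstar_identity[of "1::'b"] by simp
  then have "norm (1::'b) = 0 \<or> norm (1::'b) = 1"
    by (simp add: power2_eq_square)
  then show ?thesis by auto
qed

lemma norm_scaleC_one_le: "norm (c *\<^sub>C (1 :: 'b::unital_cstar_algebra)) \<le> cmod c"
  using mult_left_mono[OF norm_one_le, of "cmod c"] by (simp add: norm_scaleC)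

lemma trivial_algebra:
  assumes "(1 :: 'b::unital_cstar_algebra) = 0"
  shows "x = (0 :: 'b)"
  by (metis assms mult_1_right mult_zero_right)

lemma norm_power_le:
  "norm (x ^ n) \<le> norm (x :: 'b::unital_cstar_algebra) ^ n"
proof (induction n)
  case 0
  then show ?case by (simp add: norm_one_le)
next
  case (Suc n)
  have "norm (x * x ^ n) \<le> norm x * norm (x ^ n)" by (rule norm_mult_ineq)
  also have "\<dots> \<le> norm x * norm x ^ n" using Suc by (simp add: mult_left_mono)
  finally show ?case by simp
qed

lemma scaleC_power: "(c *\<^sub>C x) ^ n = c ^ n *\<^sub>C (x :: 'b::unital_cstar_algebra) ^ n"
  by (induction n) (auto simp: mult.commute)

lemma star_power: "star (x ^ n) = star (x :: 'b::unital_cstar_algebra) ^ n"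
  by (induction n) (auto simp: star_mult power_commutes)

lemma norm_power2_selfadjoint:
  "star y = y \<Longrightarrow> norm (y * y) = (norm (y :: 'b::unital_cstar_algebra))\<^sup>2"
  using cstar_identity[of y] by simp

text \<open>Repeated squaring with the C*-identity, which explains the exponents
  \<open>2 ^ k\<close> in the spectral estimate below.\<close>

lemma norm_power_selfadjoint:
  assumes "star y = (y :: 'b::unital_cstar_algebra)"
  shows "norm (y ^ (2 ^ k)) = norm y ^ (2 ^ k)"
proof (induction k)
  case (Suc k)
  have "norm (y ^ (2 ^ Suc k)) = norm (y ^ 2 ^ k * y ^ 2 ^ k)"
    by (simp add: power_add mult_2)
  also have "\<dots> = (norm (y ^ (2 ^ k)))\<^sup>2"
    by (rule norm_power2_selfadjoint) (simp add: star_power assms)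
  finally show ?case using Suc by (simp add: power_mult[symmetric] mult.commute)
qed simp

text \<open>The value is junk (an arbitrary element) at non-invertible arguments.\<close>

definition alg_inverse :: "'b::unital_cstar_algebra \<Rightarrow> 'b" where
  "alg_inverse x = (SOME y. x * y = 1 \<and> y * x = 1)"

lemma invertibles_UNIV_iff:
  "x \<in> invertibles UNIV \<longleftrightarrow> (\<exists>y. x * y = 1 \<and> y * x = 1)"
  by (simp add: invertibles_def)

lemma invertiblesI: "x * y = 1 \<Longrightarrow> y * x = 1 \<Longrightarrow> x \<in> invertibles UNIV"
  by (auto simp: invertibles_UNIV_iff)

lemma alg_inverse:
  assumes "x \<in> invertibles UNIV"
  shows "x * alg_inverse x = 1" "alg_inverse x * x = 1"
  using someI_ex[of "\<lambda>y. x * y = 1 \<and> y * x = 1"] assms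
  by (auto simp: invertibles_UNIV_iff alg_inverse_def)

lemma alg_inverse_unique:
  assumes "x * y = 1" "y * x = 1"
  shows "alg_inverse x = y"
proof -
  have "alg_inverse x = y * x * alg_inverse x" using assms by simp
  also have "\<dots> = y"
    using alg_inverse(1)[OF invertiblesI[OF assms]] by (simp add: mult.assoc)
  finally show ?thesis .
qed

lemma one_invertible [simp]: "1 \<in> invertibles (UNIV :: 'b::unital_cstar_algebra set)"
  by (rule invertiblesI[of _ 1]) auto

lemma invertibles_mult:
  assumes "x \<in> invertibles UNIV" "y \<in> invertibles UNIV"
  shows "x * y \<in> invertibles (UNIV :: 'b::unital_cstar_algebra set)"
proof (rule invertiblesI)
  have "x * y * (alg_inverse y * alg_inverse x) = x * (y * alg_inverse y) * alg_inverse x"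
    by (simp only: mult.assoc)
  then show "x * y * (alg_inverse y * alg_inverse x) = 1" by (simp add: alg_inverse assms)
  have "alg_inverse y * alg_inverse x * (x * y) = alg_inverse y * (alg_inverse x * x) * y"
    by (simp only: mult.assoc)
  then show "alg_inverse y * alg_inverse x * (x * y) = 1" by (simp add: alg_inverse assms)
qed

lemma invertibles_scaleC:
  assumes "x \<in> invertibles UNIV" "c \<noteq> 0"
  shows "c *\<^sub>C x \<in> invertibles (UNIV :: 'b::unital_cstar_algebra set)"
  by (rule invertiblesI[of _ "inverse c *\<^sub>C alg_inverse x"]) (simp_all add: alg_inverse assms)

lemma invertibles_scaleC_iff:
  assumes "c \<noteq> 0"
  shows "c *\<^sub>C x \<in> invertibles UNIV \<longleftrightarrow> x \<in> invertibles (UNIV :: 'b::unital_cstar_algebra set)"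
proof
  assume "c *\<^sub>C x \<in> invertibles UNIV"
  then show "x \<in> invertibles UNIV"
    using invertibles_scaleC[of "c *\<^sub>C x" "inverse c"] assms by simp
qed (rule invertibles_scaleC[OF _ assms])

lemma one_minus_invertible:
  assumes "norm x < 1"
  shows "1 - x \<in> invertibles (UNIV :: 'b::unital_cstar_algebra set)"
proof -
  have sm: "summable (\<lambda>n. x ^ n)"
    by (rule summable_comparison_test[of _ "\<lambda>n. norm x ^ n"])
      (use assms in \<open>auto simp: norm_power_le intro!: summable_geometric\<close>)
  let ?S = "\<Sum>n. x ^ n"
  have *: "?S = 1 + (\<Sum>n. x ^ Suc n)"
    using suminf_split_head[OF sm] by simp
  have "(\<Sum>n. x ^ Suc n) = x * ?S"
    using suminf_mult[OF sm, of x] by simp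
  moreover have "(\<Sum>n. x ^ Suc n) = ?S * x"
    using suminf_mult2[OF sm, of x] by (simp add: power_commutes)
  ultimately show ?thesis
    using * by (intro invertiblesI[of _ ?S]) (auto simp: algebra_simps)
qed

lemma invertible_near_one:
  "norm (x - 1) < 1 \<Longrightarrow> x \<in> invertibles (UNIV :: 'b::unital_cstar_algebra set)"
  using one_minus_invertible[of "1 - x"] by (simp add: norm_minus_commute)

text \<open>Neumann series for \<open>x = a * (1 - alg_inverse a * (a - x))\<close>. The
  quantitative part comes from the resolvent identity for the two inverses; the lemma serves both
  openness of the invertibles and continuity of inversion.\<close>

lemma invertible_perturb:
  fixes a x :: "'b::unital_cstar_algebra"
  assumes a: "a \<in> invertibles UNIV" and "norm (alg_inverse a) * norm (a - x) \<le> 1/2"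
  shows "x \<in> invertibles UNIV"
    "norm (alg_inverse x - alg_inverse a) \<le> 2 * (norm (alg_inverse a))\<^sup>2 * norm (a - x)"
proof -
  let ?a = "alg_inverse a"
  have "norm (?a * (a - x)) < 1" using assms(2) norm_mult_ineq[of ?a "a - x"] by simp
  then have "1 - ?a * (a - x) \<in> invertibles UNIV" by (rule one_minus_invertible)
  then have "a * (1 - ?a * (a - x)) \<in> invertibles UNIV" using a by (rule invertibles_mult[rotated])
  moreover have "a * (1 - ?a * (a - x)) = x"
    using alg_inverse(1)[OF a] by (simp add: right_diff_distrib mult.assoc[symmetric])
  ultimately show x: "x \<in> invertibles UNIV" by simp
  let ?x = "alg_inverse x"
  have eq: "?x - ?a = ?x * (a - x) * ?a"
    using alg_inverse[OF a] alg_inverse[OF x]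
    by (simp add: right_diff_distrib left_diff_distrib mult.assoc)
  have "norm (?x * (a - x) * ?a) \<le> norm ?x * norm (a - x) * norm ?a"
    by (meson norm_mult_ineq norm_ge_zero mult_right_mono order_trans)
  then have d: "norm (?x - ?a) \<le> norm ?x * (norm ?a * norm (a - x))"
    by (simp add: eq mult.commute mult.left_commute)
  \<comment> \<open>Half of \<open>norm ?x\<close> is absorbed, which bounds the still unknown
    inverse by \<open>2 * norm ?a\<close>.\<close>
  also have "\<dots> \<le> norm ?x * (1/2)" using assms(2) by (intro mult_left_mono) auto
  finally have "norm ?x \<le> 2 * norm ?a" using norm_triangle_sub[of ?x ?a] by simp
  then have "norm ?x * (norm ?a * norm (a - x)) \<le> 2 * norm ?a * (norm ?a * norm (a - x))"
    by (intro mult_right_mono) auto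
  with d show "norm (?x - ?a) \<le> 2 * (norm ?a)\<^sup>2 * norm (a - x)"
    by (simp add: power2_eq_square mult.assoc)
qed

lemma open_invertibles: "open (invertibles (UNIV :: 'b::unital_cstar_algebra set))"
proof (rule openI)
  fix a :: 'b assume a: "a \<in> invertibles UNIV"
  \<comment> \<open>The \<open>+ 1\<close> keeps the radius positive in the zero algebra, where the
    inverse has norm \<open>0\<close>.\<close>
  let ?e = "1 / (2 * (norm (alg_inverse a) + 1))"
  have pos: "norm (alg_inverse a) + 1 > 0" by (simp add: add_nonneg_pos)
  have "ball a ?e \<subseteq> invertibles UNIV"
  proof
    fix x assume "x \<in> ball a ?e"
    then have "norm (a - x) \<le> ?e" by (simp add: dist_norm)
    then have "(norm (alg_inverse a) + 1) * norm (a - x) \<le> (norm (alg_inverse a) + 1) * ?e"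
      using pos by (intro mult_left_mono) auto
    also have "\<dots> = 1/2" using pos by simp
    finally have "(norm (alg_inverse a) + 1) * norm (a - x) \<le> 1/2" .
    then have "norm (alg_inverse a) * norm (a - x) \<le> 1/2"
      by (smt (verit) mult_right_mono norm_ge_zero)
    then show "x \<in> invertibles UNIV" using invertible_perturb(1)[OF a] by blast
  qed
  moreover have "?e > 0" using pos by simp
  ultimately show "\<exists>e>0. ball a e \<subseteq> invertibles UNIV" by blast
qed

lemma continuous_on_alg_inverse:
  "continuous_on (invertibles UNIV) (alg_inverse :: 'b::unital_cstar_algebra \<Rightarrow> 'b)"
proof (rule continuous_at_imp_continuous_on, rule ballI)
  fix a :: 'b assume a: "a \<in> invertibles UNIV"
  define K where "K = norm (alg_inverse a)"
  have "((\<lambda>x. a - x) \<longlongrightarrow> a - a) (at a)" by (intro tendsto_intros)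
  then have n: "((\<lambda>x. norm (a - x)) \<longlongrightarrow> 0) (at a)" by (simp add: tendsto_norm_zero)
  have "\<forall>\<^sub>F x in at a. K * norm (a - x) < 1/2"
    by (rule order_tendstoD(2)[OF tendsto_mult_right_zero[OF n]]) simp
  then have "\<forall>\<^sub>F x in at a. norm (alg_inverse x - alg_inverse a) \<le> 2 * K\<^sup>2 * norm (a - x)"
    by eventually_elim (use invertible_perturb(2)[OF a] in \<open>simp add: K_def\<close>)
  then have "((\<lambda>x. alg_inverse x - alg_inverse a) \<longlongrightarrow> 0) (at a)"
    using tendsto_mult_right_zero[OF n] by (rule Lim_null_comparison)
  then show "isCont alg_inverse a" by (simp add: isCont_def LIM_zero_iff)
qed

lemma spectrum_norm_bound:
  assumes "z \<in> spectrum (a :: 'b::unital_cstar_algebra)"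
  shows "cmod z \<le> norm a"
proof (rule ccontr)
  assume "\<not> cmod z \<le> norm a"
  then have z: "norm a < cmod z" by simp
  then have z0: "z \<noteq> 0" using norm_ge_zero[of a] by fastforce
  have "norm (inverse z *\<^sub>C a) < 1"
    using z z0 by (simp add: norm_scaleC norm_inverse inverse_eq_divide norm_divide pos_divide_less_eq)
  then have "z *\<^sub>C (1 - inverse z *\<^sub>C a) \<in> invertibles UNIV"
    using z0 by (intro invertibles_scaleC one_minus_invertible) auto
  then show False using assms z0 by (simp add: spectrum_def scaleC.diff_right)
qed

lemma compact_spectrum: "compact (spectrum (a :: 'b::unital_cstar_algebra))"
proof (rule compact_eq_bounded_closed[THEN iffD2], intro conjI)
  show "bounded (spectrum a)"
    using spectrum_norm_bound by (meson boundedI)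
  have "continuous_on UNIV (\<lambda>z. z *\<^sub>C 1 - a)"
    by (intro continuous_intros scaleC.continuous_on)
  then have "open ((\<lambda>z. z *\<^sub>C 1 - a) -` invertibles UNIV)"
    by (rule open_vimage[OF open_invertibles])
  moreover have "spectrum a = - ((\<lambda>z. z *\<^sub>C 1 - a) -` invertibles UNIV)"
    by (auto simp: spectrum_def)
  ultimately show "closed (spectrum a)" by (simp add: closed_def)
qed

text \<open>Shifting by an imaginary number: for real \<open>t\<close> the C*-identity gives
  \<open>\<bar>z + \<i>t\<bar>\<^sup>2 \<le> \<parallel>a + \<i>t\<parallel>\<^sup>2 \<le> \<parallel>a\<parallel>\<^sup>2 + t\<^sup>2\<close>, where the left side is \<open>t\<^sup>2 + 2t Im z + \<bar>z\<bar>\<^sup>2\<close>.\<close>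

lemma spectrum_selfadjoint_real:
  assumes a: "star a = (a :: 'b::unital_cstar_algebra)" and z: "z \<in> spectrum a"
  shows "Im z = 0"
proof -
  have *: "(cmod z)\<^sup>2 + 2 * t * Im z \<le> (norm a)\<^sup>2" for t :: real
  proof -
    let ?s = "\<i> * of_real t" let ?y = "a + ?s *\<^sub>C 1"
    have "z + ?s \<in> spectrum ?y"
      using z by (simp add: spectrum_def scaleC_add_left algebra_simps)
    then have "(cmod (z + ?s))\<^sup>2 \<le> (norm ?y)\<^sup>2"
      by (intro power_mono spectrum_norm_bound) auto
    also have "\<dots> = norm (star ?y * ?y)" by (simp add: cstar_identity)
    also have "star ?y * ?y = a * a + (of_real (t\<^sup>2)) *\<^sub>C 1"
      by (simp add: star_add star_scaleC a algebra_simps power2_eq_square scaleC.minus_left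
        scaleC.add_right scaleC.diff_right)
    also have "norm \<dots> \<le> norm (a * a) + t\<^sup>2"
      using norm_triangle_ineq[of "a * a" "(of_real (t\<^sup>2)) *\<^sub>C 1"]
        norm_scaleC_one_le[of "of_real (t\<^sup>2)", where 'b='b] by (simp add: norm_power)
    also have "norm (a * a) = (norm a)\<^sup>2" by (rule norm_power2_selfadjoint[OF a])
    finally show ?thesis by (simp add: cmod_power2 power2_sum algebra_simps)
  qed
  show ?thesis
  proof (rule ccontr)
    assume "Im z \<noteq> 0"
    \<comment> \<open>This \<open>t\<close> makes the linear term exceed the bound by
      \<open>1\<close>.\<close>
    then have "2 * (((norm a)\<^sup>2 + 1) / (2 * Im z)) * Im z = (norm a)\<^sup>2 + 1" by simp
    with *[of "((norm a)\<^sup>2 + 1) / (2 * Im z)"] have "(cmod z)\<^sup>2 + 1 \<le> 0" by linarith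
    then show False by (smt (verit) zero_le_power2)
  qed
qed

section \<open>Norm and spectrum of self-adjoint elements\<close>

text \<open>Rickart's elementary argument.  If \<open>\<parallel>w\<parallel> = 1\<close> and \<open>1 - \<mu>w\<close> is invertible on the closed unit
  disc, then \<open>(1 - (\<mu>w)\<^sup>N)\<inverse>\<close> is the mean of \<open>(1 - \<omega>\<mu>w)\<inverse>\<close> over the \<open>N\<close>-th roots of unity \<open>\<omega>\<close>; by uniform
  continuity it changes little when \<open>\<mu>\<close> is replaced by \<open>t\<mu>\<close> with \<open>t < 1\<close> close to \<open>1\<close>, uniformly in
  \<open>N\<close>.  For \<open>N = 2\<^sup>k \<rightarrow> \<infinity>\<close> the latter tends to \<open>1\<close>, which contradicts \<open>\<parallel>w\<^sup>N\<parallel> = 1\<close>.\<close>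

lemma alg_inverse_one_minus_square:
  fixes z :: "'b::unital_cstar_algebra"
  assumes "1 - z \<in> invertibles UNIV" "1 + z \<in> invertibles UNIV"
  shows "1 - z * z \<in> invertibles UNIV"
    and "alg_inverse (1 - z * z) = (1/2) *\<^sub>R (alg_inverse (1 - z) + alg_inverse (1 + z))"
proof -
  let ?p = "alg_inverse (1 - z)" and ?q = "alg_inverse (1 + z)"
  have p: "(1 - z) * ?p = 1" "?p * (1 - z) = 1" and q: "(1 + z) * ?q = 1" "?q * (1 + z) = 1"
    using alg_inverse assms by blast+
  have f: "1 - z * z = (1 + z) * (1 - z)" "1 - z * z = (1 - z) * (1 + z)"
    by (simp_all add: algebra_simps)
  have l: "(1 - z * z) * ?p = 1 + z" "?p * (1 - z * z) = 1 + z"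
    using p by (simp_all only: f(1) mult.assoc mult_1_right, simp_all only: f(2) flip: f(1))
      (metis f mult.assoc mult_1_left)
  have r: "(1 - z * z) * ?q = 1 - z" "?q * (1 - z * z) = 1 - z"
    using q by (metis f mult.assoc mult_1_left mult_1_right)+
  have "(1 - z * z) * ((1/2) *\<^sub>R (?p + ?q)) = 1" "((1/2) *\<^sub>R (?p + ?q)) * (1 - z * z) = 1"
    by (simp_all add: distrib_left distrib_right l r scaleR_2[symmetric] flip: scaleR_add_right)
  then show "1 - z * z \<in> invertibles UNIV" "alg_inverse (1 - z * z) = (1/2) *\<^sub>R (?p + ?q)"
    by (rule invertiblesI, rule alg_inverse_unique)
qed

text \<open>The inverse \<open>S\<close> satisfies \<open>S - 1 = z * S\<close>. The constants are
  budgeted so that \<open>1/4\<close>, plus \<open>1/8\<close> from uniform continuity, stays below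
  the \<open>1/2\<close> demanded by \<open>norm_lt_one_if_alg_inverse_near_one\<close>.\<close>

lemma norm_alg_inverse_one_minus_diff:
  fixes z :: "'b::unital_cstar_algebra"
  assumes z: "norm z \<le> 1/8"
  shows "norm (alg_inverse (1 - z) - 1) \<le> 1/4"
proof -
  have inv: "1 - z \<in> invertibles UNIV" using z by (intro one_minus_invertible) auto
  let ?S = "alg_inverse (1 - z)"
  have eq: "?S - 1 = z * ?S" using alg_inverse(1)[OF inv] by (simp add: algebra_simps)
  have "norm (z * ?S) \<le> norm z * norm ?S" by (rule norm_mult_ineq)
  also have "\<dots> \<le> 1/8 * norm ?S" using z by (intro mult_right_mono) auto
  finally have "norm (?S - 1) \<le> 1/8 * norm ?S" using eq by simp
  moreover have "norm ?S \<le> norm (?S - 1) + 1"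
    using norm_triangle_sub[of ?S 1] norm_one_le[where 'b='b] by linarith
  ultimately show ?thesis by linarith
qed

text \<open>Since \<open>z = (S - 1) * (1 - z)\<close> for the inverse \<open>S\<close>, one gets
  \<open>norm z < (1 + norm z) / 2\<close>.\<close>

lemma norm_lt_one_if_alg_inverse_near_one:
  fixes z :: "'b::unital_cstar_algebra"
  assumes inv: "1 - z \<in> invertibles UNIV" and n: "norm (alg_inverse (1 - z) - 1) < 1/2"
  shows "norm z < 1"
proof -
  let ?S = "alg_inverse (1 - z)"
  have eq: "z = (?S - 1) * (1 - z)" using alg_inverse(2)[OF inv] by (simp add: algebra_simps)
  have "norm z \<le> norm (?S - 1) * norm (1 - z)" by (subst eq) (rule norm_mult_ineq)
  also have "\<dots> \<le> norm (?S - 1) * (1 + norm z)"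
    using norm_triangle_ineq4[of 1 z] norm_one_le[where 'b='b] by (intro mult_left_mono norm_ge_zero) linarith
  also have "\<dots> < 1/2 * (1 + norm z)"
    using n by (intro mult_strict_right_mono) (auto simp: add_pos_nonneg)
  finally show ?thesis by simp
qed

text \<open>The average over roots of unity is taken one halving at a time by
  \<open>alg_inverse_one_minus_square\<close>. A mean of two differences bounded by
  \<open>\<epsilon>\<close> is bounded by \<open>\<epsilon>\<close>, so the estimate is uniform in
  \<open>k\<close>. The induction has to cover the whole unit circle, since each step also uses a
  rotated \<open>\<mu>\<close>.\<close>

lemma alg_inverse_power_diff_bound:
  fixes w :: "'b::unital_cstar_algebra"
  assumes inv: "\<And>\<mu>. cmod \<mu> \<le> 1 \<Longrightarrow> 1 - \<mu> *\<^sub>C w \<in> invertibles UNIV"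
    and t: "0 \<le> t" "t \<le> 1"
    and close: "\<And>\<mu>. cmod \<mu> = 1 \<Longrightarrow>
      norm (alg_inverse (1 - \<mu> *\<^sub>C w) - alg_inverse (1 - (of_real t * \<mu>) *\<^sub>C w)) \<le> \<epsilon>"
    and "cmod \<mu> = 1"
  shows "1 - (\<mu> *\<^sub>C w) ^ (2 ^ k) \<in> invertibles UNIV
    \<and> 1 - ((of_real t * \<mu>) *\<^sub>C w) ^ (2 ^ k) \<in> invertibles UNIV
    \<and> norm (alg_inverse (1 - (\<mu> *\<^sub>C w) ^ (2 ^ k))
        - alg_inverse (1 - ((of_real t * \<mu>) *\<^sub>C w) ^ (2 ^ k))) \<le> \<epsilon>"
  using \<open>cmod \<mu> = 1\<close>
proof (induction k arbitrary: \<mu>)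
  case 0
  then show ?case using t by (simp add: inv close norm_mult)
next
  case (Suc k)
  \<comment> \<open>Rotation by \<open>\<omega>\<close> changes the sign of the
    \<open>2 ^ k\<close>-th power, so the two induction hypotheses supply the factors
    \<open>1 - F \<mu>\<close> and \<open>1 + F \<mu>\<close>.\<close>
  define \<omega> where "\<omega> = cis (pi / 2 ^ k)"
  have "\<omega> ^ (2 ^ k) = cis (real (2 ^ k) * (pi / 2 ^ k))" unfolding \<omega>_def by (rule Complex.DeMoivre)
  also have "real (2 ^ k) * (pi / 2 ^ k) = pi" by simp
  finally have \<omega>: "\<omega> ^ (2 ^ k) = -1" "cmod (\<mu> * \<omega>) = 1"
    using Suc.prems by (simp_all add: \<omega>_def norm_mult)
  define F where "F \<nu> = (\<nu> *\<^sub>C w) ^ (2 ^ k)" for \<nu>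
  have neg: "F (\<nu> * \<omega>) = - F \<nu>" for \<nu>
    using \<omega>(1) by (simp add: F_def scaleC_power power_mult_distrib scaleC.minus_left)
  have sq: "(\<nu> *\<^sub>C w) ^ (2 ^ Suc k) = F \<nu> * F \<nu>" for \<nu>
    by (simp add: F_def power_add[symmetric] mult_2)
  note IH = Suc.IH[OF Suc.prems, folded F_def] Suc.IH[OF \<omega>(2), folded F_def]
  have a: "of_real t * (\<mu> * \<omega>) = (of_real t * \<mu>) * \<omega>" by simp
  have "1 - F \<mu> \<in> invertibles UNIV" "1 + F \<mu> \<in> invertibles UNIV"
    "1 - F (of_real t * \<mu>) \<in> invertibles UNIV" "1 + F (of_real t * \<mu>) \<in> invertibles UNIV"
    using IH unfolding a neg by simp_all
  note S = alg_inverse_one_minus_square[OF this(1,2)] alg_inverse_one_minus_square[OF this(3,4)]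
  have "norm ((1/2) *\<^sub>R (u + v) - (1/2) *\<^sub>R (u' + v')) \<le> \<epsilon>"
    if "norm (u - u') \<le> \<epsilon>" "norm (v - v') \<le> \<epsilon>" for u v u' v' :: 'b
  proof -
    have "(1/2) *\<^sub>R (u + v) - (1/2) *\<^sub>R (u' + v') = (1/2) *\<^sub>R ((u - u') + (v - v'))"
      by (simp add: algebra_simps)
    also have "norm \<dots> \<le> (1/2) * (norm (u - u') + norm (v - v'))"
      by (simp add: norm_triangle_ineq)
    also have "\<dots> \<le> (1/2) * (\<epsilon> + \<epsilon>)"
      using that by (intro mult_left_mono add_mono) auto
    finally show ?thesis by simp
  qed
  then have "norm (alg_inverse (1 - F \<mu> * F \<mu>)
      - alg_inverse (1 - F (of_real t * \<mu>) * F (of_real t * \<mu>))) \<le> \<epsilon>"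
    using IH unfolding a neg S by simp
  with S show ?case unfolding sq by blast
qed

text \<open>The form of the spectral radius formula on which every later norm estimate in the
  calculus rests.\<close>

lemma norm_le_spectrum_bound:
  fixes y :: "'b::unital_cstar_algebra"
  assumes y: "star y = y" and r: "0 \<le> r" and le: "\<And>z. z \<in> spectrum y \<Longrightarrow> cmod z \<le> r"
  shows "norm y \<le> r"
proof (rule ccontr)
  assume "\<not> norm y \<le> r"
  then have R: "r < norm y" "0 < norm y" using r by auto
  define w where "w = of_real (inverse (norm y)) *\<^sub>C y"
  have w: "star w = w" "norm w = 1" using R by (simp_all add: w_def star_scaleC y norm_scaleC norm_inverse)
  have inv: "1 - \<mu> *\<^sub>C w \<in> invertibles UNIV" if "cmod \<mu> \<le> 1" for \<mu>
  proof (cases "\<mu> = 0")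
    case False
    \<comment> \<open>Up to a scalar, \<open>1 - \<mu> *\<^sub>C w\<close> is
      \<open>?z *\<^sub>C 1 - y\<close>, and \<open>?z\<close> is too large to be in the
      spectrum.\<close>
    let ?z = "of_real (norm y) / \<mu>"
    have "cmod ?z \<ge> norm y"
      using that False R by (simp add: norm_divide pos_le_divide_eq mult_left_le)
    then have "?z \<notin> spectrum y" using le R by force
    then have "(inverse ?z) *\<^sub>C (?z *\<^sub>C 1 - y) \<in> invertibles UNIV"
      using False R by (intro invertibles_scaleC) (auto simp: spectrum_def)
    also have "(inverse ?z) *\<^sub>C (?z *\<^sub>C 1 - y) = 1 - \<mu> *\<^sub>C w"
      using False R by (auto simp: scaleC.diff_right w_def field_simps)
    finally show ?thesis .
  qed simp
  have "continuous_on (cball 0 1) (alg_inverse \<circ> (\<lambda>\<mu>. 1 - \<mu> *\<^sub>C w))"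
    by (intro continuous_on_compose continuous_on_subset[OF continuous_on_alg_inverse]
        continuous_intros scaleC.continuous_on) (auto simp: inv)
  then have "uniformly_continuous_on (cball 0 1) (\<lambda>\<mu>. alg_inverse (1 - \<mu> *\<^sub>C w))"
    by (intro compact_uniformly_continuous) (auto simp: o_def)
  then obtain d where d: "d > 0" "\<And>\<mu> \<nu>. \<lbrakk>cmod \<mu> \<le> 1; cmod \<nu> \<le> 1; cmod (\<mu> - \<nu>) < d\<rbrakk> \<Longrightarrow>
      norm (alg_inverse (1 - \<mu> *\<^sub>C w) - alg_inverse (1 - \<nu> *\<^sub>C w)) < 1/8"
    unfolding uniformly_continuous_on_def dist_norm
    by (metis mem_cball_0 zero_less_divide_1_iff zero_less_numeral)
  define t where "t = max 0 (1 - d/2)"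
  have t: "0 \<le> t" "t < 1" "1 - t < d" using d(1) by (auto simp: t_def)
  have close: "norm (alg_inverse (1 - \<mu> *\<^sub>C w) - alg_inverse (1 - (of_real t * \<mu>) *\<^sub>C w)) \<le> 1/8"
    if "cmod \<mu> = 1" for \<mu>
  proof -
    have "\<mu> - of_real t * \<mu> = of_real (1 - t) * \<mu>" by (simp add: algebra_simps)
    then have "cmod (\<mu> - of_real t * \<mu>) = 1 - t" using that t by (simp add: norm_mult del: of_real_diff)
    then show ?thesis using d(2)[of \<mu> "of_real t * \<mu>"] that t by (simp add: norm_mult)
  qed
  obtain n where n: "t ^ n < 1/8" using real_arch_pow_inv[of "1/8" t] t by auto
  have "t ^ (2 ^ n) \<le> t ^ n" using t less_exp[of n] by (intro power_decreasing) auto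
  with n have tn: "t ^ (2 ^ n) \<le> 1/8" by simp
  have *: "1 - w ^ (2 ^ n) \<in> invertibles UNIV"
    "norm (alg_inverse (1 - w ^ (2 ^ n)) - alg_inverse (1 - (of_real t *\<^sub>C w) ^ (2 ^ n))) \<le> 1/8"
    using alg_inverse_power_diff_bound[of w t "1/8" 1 n, OF inv _ _ close] t by simp_all
  have "norm ((of_real t *\<^sub>C w) ^ (2 ^ n)) \<le> 1/8"
    using norm_power_le[of "of_real t *\<^sub>C w" "2 ^ n"] tn t by (simp add: norm_scaleC w)
  then have "norm (alg_inverse (1 - (of_real t *\<^sub>C w) ^ (2 ^ n)) - 1) \<le> 1/4"
    by (rule norm_alg_inverse_one_minus_diff)
  with *(2) have "norm (alg_inverse (1 - w ^ (2 ^ n)) - 1) < 1/2"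
    using norm_triangle_le[of "alg_inverse (1 - w ^ 2 ^ n) - alg_inverse (1 - (of_real t *\<^sub>C w) ^ 2 ^ n)"
        "alg_inverse (1 - (of_real t *\<^sub>C w) ^ 2 ^ n) - 1" "3/8"] by simp
  then have "norm (w ^ (2 ^ n)) < 1" by (rule norm_lt_one_if_alg_inverse_near_one[OF *(1)])
  then show False by (simp add: norm_power_selfadjoint w)
qed

text \<open>Over an empty spectrum the preceding bound holds vacuously with \<open>r = 0\<close>,
  which forces \<open>a = 0\<close>; but \<open>0\<close> is in the spectrum of
  \<open>0\<close>.\<close>

lemma spectrum_selfadjoint_nonempty:
  assumes a: "star a = (a :: 'b::unital_cstar_algebra)" and ne: "(1::'b) \<noteq> 0"
  shows "spectrum a \<noteq> {}"
proof
  assume e: "spectrum a = {}"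
  then have "a = 0" using norm_le_spectrum_bound[OF a, of 0] by simp
  then have "0 \<in> spectrum a" using ne by (simp add: spectrum_def invertibles_UNIV_iff)
  with e show False by simp
qed


section \<open>Polynomials in an algebra element and their norm on the spectrum\<close>

definition poly_eval :: "'b::unital_cstar_algebra \<Rightarrow> complex poly \<Rightarrow> 'b" where
  "poly_eval a p = fold_coeffs (\<lambda>c y. c *\<^sub>C 1 + a * y) p 0"

lemma poly_eval_0 [simp]: "poly_eval a 0 = 0"
  by (simp add: poly_eval_def)

lemma poly_eval_pCons [simp]: "poly_eval a (pCons c p) = c *\<^sub>C 1 + a * poly_eval a p"
  by (cases "c = 0 \<and> p = 0") (auto simp: poly_eval_def)

lemma poly_eval_add: "poly_eval a (p + q) = poly_eval a p + poly_eval a q"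
  by (induction p q rule: poly_induct2) (simp_all add: scaleC_add_left algebra_simps)

lemma poly_eval_smult: "poly_eval a (smult c p) = c *\<^sub>C poly_eval a p"
  by (induction p) (simp_all add: scaleC_add_right)

lemma poly_eval_diff: "poly_eval a (p - q) = poly_eval a p - poly_eval a q"
  using poly_eval_add[of a "p - q" q] by simp

lemma poly_eval_mult: "poly_eval a (p * q) = poly_eval a p * poly_eval a q"
  by (induction p) (simp_all add: poly_eval_add poly_eval_smult distrib_right mult.assoc)

lemma poly_eval_commute: "a * poly_eval a p = poly_eval a p * a"
proof (induction p)
  case (pCons c p)
  have "a * (a * poly_eval a p) = a * poly_eval a p * a"
    by (subst pCons.IH) (simp only: mult.assoc)
  then show ?case by (simp add: distrib_left distrib_right)
qed simp

lemma star_poly_eval: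
  assumes "star a = a"
  shows "star (poly_eval a p) = poly_eval a (map_poly cnj p)"
  by (induction p)
    (simp_all add: map_poly_pCons star_add star_scaleC star_mult assms poly_eval_commute)

text \<open>Over the complex numbers \<open>p\<close> splits into linear factors, each with its root
  off the spectrum and hence invertible at \<open>a\<close>. This is the half of the spectral
  mapping theorem behind the norm bound below.\<close>

lemma poly_eval_invertible:
  assumes "p \<noteq> 0" "\<And>z. z \<in> spectrum a \<Longrightarrow> poly p z \<noteq> 0"
  shows "poly_eval a p \<in> invertibles UNIV"
  using assms
proof (induction "degree p" arbitrary: p rule: less_induct)
  case less
  show ?case
  proof (cases "degree p = 0")
    case True
    then obtain c where "p = [:c:]" by (rule degree_eq_zeroE)
    with less.prems(1) show ?thesis by (simp add: invertibles_scaleC)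
  next
    case False
    then obtain z where z: "poly p z = 0"
      using fundamental_theorem_of_algebra[of p] by (auto simp: constant_degree)
    then obtain q where q: "p = [:-z, 1:] * q" by (auto simp: poly_eq_0_iff_dvd)
    have "q \<noteq> 0" using less.prems(1) q by auto
    then have "degree q < degree p" unfolding q by (subst degree_mult_eq) auto
    then have "poly_eval a q \<in> invertibles UNIV"
      using less.hyps[of q] \<open>q \<noteq> 0\<close> less.prems(2) q by auto
    moreover have "z *\<^sub>C 1 - a \<in> invertibles UNIV"
      using z less.prems(2) by (auto simp: spectrum_def)
    then have "(-1) *\<^sub>C (z *\<^sub>C 1 - a) \<in> invertibles UNIV"
      by (intro invertibles_scaleC) auto
    then have "poly_eval a [:-z, 1:] \<in> invertibles UNIV"
      by (simp add: scaleC.minus_left)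
    ultimately show ?thesis unfolding q poly_eval_mult by (intro invertibles_mult)
  qed
qed

text \<open>\<open>poly_eval a p\<close> need not be self-adjoint, so the spectral bound is applied
  to \<open>star ?y * ?y\<close>. That is again a polynomial in \<open>a\<close>, with values
  \<open>|p|\<^sup>2\<close> on the real spectrum.\<close>

lemma norm_poly_eval_le:
  fixes a :: "'b::unital_cstar_algebra"
  assumes a: "star a = a" and M: "0 \<le> M" "\<And>z. z \<in> spectrum a \<Longrightarrow> cmod (poly p z) \<le> M"
  shows "norm (poly_eval a p) \<le> M"
proof (cases "(1::'b) = 0")
  case True
  then show ?thesis using trivial_algebra M by (metis norm_zero)
next
  case False
  let ?y = "poly_eval a p"
  define q where "q = map_poly cnj p * p"
  have qa: "poly_eval a q = star ?y * ?y" by (simp add: q_def poly_eval_mult star_poly_eval a)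
  have qz: "poly q z = of_real ((cmod (poly p z))\<^sup>2)" if "z \<in> spectrum a" for z
  proof -
    have "cnj z = z" using spectrum_selfadjoint_real[OF a that] by (simp add: complex_eq_iff)
    then have "poly (map_poly cnj p) z = cnj (poly p z)" by (metis poly_cnj complex_cnj_cnj)
    then show ?thesis by (simp add: q_def mult.commute[of "cnj _"] complex_norm_square del: of_real_power)
  qed
  have "norm (star ?y * ?y) \<le> M\<^sup>2"
  proof (rule norm_le_spectrum_bound)
    fix l assume l: "l \<in> spectrum (star ?y * ?y)"
    have "\<exists>z\<in>spectrum a. poly q z = l"
    proof (cases "q - [:l:] = 0")
      \<comment> \<open>Here \<open>q\<close> is the constant \<open>l\<close>, so any point of the
        spectrum will do, provided there is one.\<close>
      case True
      obtain z where "z \<in> spectrum a" using spectrum_selfadjoint_nonempty[OF a False] by blast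
      then show ?thesis using True by (intro bexI[of _ z]) auto
    next
      case q0: False
      have "poly_eval a (q - [:l:]) \<notin> invertibles UNIV"
        using l invertibles_scaleC_iff[of "-1" "l *\<^sub>C 1 - star ?y * ?y"]
        by (simp add: poly_eval_diff qa spectrum_def scaleC.minus_left)
      then show ?thesis using poly_eval_invertible[OF q0, of a] by auto
    qed
    then obtain z where z: "z \<in> spectrum a" "poly q z = l" by blast
    then show "cmod l \<le> M\<^sup>2" using qz[OF z(1)] M(2)[OF z(1)] by (auto simp: norm_power power_mono)
  qed (auto simp: star_mult)
  then show ?thesis using M by (simp add: cstar_identity power2_le_iff_abs_le)
qed

section \<open>Existence of the continuous functional calculus\<close>

text \<open>Extension of \<open>poly_eval\<close> by continuity. Kept as a relation, it lets each
  algebraic law be proved with whatever approximating polynomials are at hand; uniqueness then makes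
  it a function.\<close>

definition calculus_value :: "'b::unital_cstar_algebra \<Rightarrow> (complex \<Rightarrow> complex) \<Rightarrow> 'b \<Rightarrow> bool" where
  "calculus_value a f y \<longleftrightarrow> (\<exists>p. uniform_limit (spectrum a) (\<lambda>n. poly (p n)) f sequentially
     \<and> (\<lambda>n. poly_eval a (p n)) \<longlonglongrightarrow> y)"

lemma real_polynomial_function_complex_poly:
  assumes "real_polynomial_function g"
  obtains p where "\<And>x. poly p (of_real x) = complex_of_real (g x)"
proof -
  obtain c n where "g = (\<lambda>x. \<Sum>i\<le>n. c i * x ^ i)"
    using assms by (auto simp: real_polynomial_function_iff_sum)
  then show ?thesis
    by (intro that[of "\<Sum>i\<le>n. monom (of_real (c i)) i"]) (simp add: poly_sum poly_monom)
qed

lemma poly_approx_on_spectrum: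
  fixes a :: "'b::unital_cstar_algebra"
  assumes a: "star a = a" and f: "continuous_on (spectrum a) f" and e: "0 < e"
  shows "\<exists>p. \<forall>z\<in>spectrum a. cmod (poly p z - f z) < e"
proof -
  let ?S = "Re ` spectrum a"
  have real: "complex_of_real (Re z) = z" if "z \<in> spectrum a" for z
    using spectrum_selfadjoint_real[OF a that] by (simp add: complex_eq_iff)
  have S: "compact ?S" by (intro compact_continuous_image continuous_intros compact_spectrum)
  have "of_real ` ?S = spectrum a" using real by (force simp: image_image)
  then have c: "continuous_on ?S (\<lambda>x. f (of_real x))"
    by (intro continuous_on_compose2[OF f] continuous_intros) auto
  obtain g where g: "real_polynomial_function g" "\<And>x. x \<in> ?S \<Longrightarrow> \<bar>Re (f (of_real x)) - g x\<bar> < e/2"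
    by (rule Stone_Weierstrass_real_polynomial_function[OF S, of "\<lambda>x. Re (f (of_real x))" "e/2"])
      (use e c in \<open>auto intro: continuous_intros\<close>)
  obtain h where h: "real_polynomial_function h" "\<And>x. x \<in> ?S \<Longrightarrow> \<bar>Im (f (of_real x)) - h x\<bar> < e/2"
    by (rule Stone_Weierstrass_real_polynomial_function[OF S, of "\<lambda>x. Im (f (of_real x))" "e/2"])
      (use e c in \<open>auto intro: continuous_intros\<close>)
  obtain p where p: "\<And>x. poly p (of_real x) = complex_of_real (g x)"
    using real_polynomial_function_complex_poly[OF g(1)] by blast
  obtain q where q: "\<And>x. poly q (of_real x) = complex_of_real (h x)"
    using real_polynomial_function_complex_poly[OF h(1)] by blast
  have "cmod (poly (p + smult \<i> q) z - f z) < e" if z: "z \<in> spectrum a" for z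
  proof -
    have "poly (p + smult \<i> q) z = of_real (g (Re z)) + \<i> * of_real (h (Re z))"
      using p[of "Re z"] q[of "Re z"] real[OF z] by simp
    then have "cmod (poly (p + smult \<i> q) z - f z) \<le> \<bar>g (Re z) - Re (f z)\<bar> + \<bar>h (Re z) - Im (f z)\<bar>"
      using cmod_le[of "poly (p + smult \<i> q) z - f z"] by simp
    then show ?thesis using g(2)[of "Re z"] h(2)[of "Re z"] z real[OF z] by (auto simp: abs_minus_commute)
  qed
  then show ?thesis by blast
qed

lemma calculus_value_unique:
  fixes a :: "'b::unital_cstar_algebra"
  assumes a: "star a = a" and "calculus_value a f y" "calculus_value a f y'"
  shows "y = y'"
proof -
  obtain p where p: "uniform_limit (spectrum a) (\<lambda>n. poly (p n)) f sequentially"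
    "(\<lambda>n. poly_eval a (p n)) \<longlonglongrightarrow> y" using assms(2) by (auto simp: calculus_value_def)
  obtain q where q: "uniform_limit (spectrum a) (\<lambda>n. poly (q n)) f sequentially"
    "(\<lambda>n. poly_eval a (q n)) \<longlonglongrightarrow> y'" using assms(3) by (auto simp: calculus_value_def)
  have u: "uniform_limit (spectrum a) (\<lambda>n z. poly (p n - q n) z) (\<lambda>z. f z - f z) sequentially"
    unfolding poly_diff by (rule uniform_limit_minus[OF p(1) q(1)])
  have "(\<lambda>n. poly_eval a (p n) - poly_eval a (q n)) \<longlonglongrightarrow> 0"
  proof (rule tendstoI)
    fix e :: real assume e: "0 < e"
    have "\<forall>\<^sub>F n in sequentially. \<forall>z\<in>spectrum a. dist (poly (p n - q n) z) (f z - f z) < e/2"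
      using uniform_limitD[OF u, of "e/2"] e by simp
    then show "\<forall>\<^sub>F n in sequentially. dist (poly_eval a (p n) - poly_eval a (q n)) 0 < e"
    proof eventually_elim
      case (elim n)
      then have "norm (poly_eval a (p n - q n)) \<le> e/2"
        using e by (intro norm_poly_eval_le[OF a]) (auto simp: less_imp_le)
      then show ?case using e by (simp add: poly_eval_diff)
    qed
  qed
  moreover have "(\<lambda>n. poly_eval a (p n) - poly_eval a (q n)) \<longlonglongrightarrow> y - y'"
    by (rule tendsto_diff[OF p(2) q(2)])
  ultimately have "y - y' = 0" using LIMSEQ_unique by blast
  then show ?thesis by simp
qed

text \<open>By \<open>norm_poly_eval_le\<close>, uniformly convergent polynomials have Cauchy values
  at \<open>a\<close>, and the algebra is complete.\<close>

lemma calculus_value_exists: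
  fixes a :: "'b::unital_cstar_algebra"
  assumes a: "star a = a" and f: "continuous_on (spectrum a) f"
  shows "\<exists>y. calculus_value a f y"
proof -
  have "\<forall>n. \<exists>p. \<forall>z\<in>spectrum a. cmod (poly p z - f z) < inverse (real (Suc n))"
    using poly_approx_on_spectrum[OF a f] by simp
  then obtain p where p: "\<And>n z. z \<in> spectrum a \<Longrightarrow> cmod (poly (p n) z - f z) < inverse (real (Suc n))"
    by metis
  have close: "cmod (poly (p n) z - f z) < e"
    if "z \<in> spectrum a" "inverse (real (Suc N)) < e" "N \<le> n" for n N z e
  proof -
    have "inverse (real (Suc n)) \<le> inverse (real (Suc N))" using that(3) by (simp add: field_simps)
    then show ?thesis using p[OF that(1), of n] that(2) by linarith
  qed
  have u: "uniform_limit (spectrum a) (\<lambda>n. poly (p n)) f sequentially"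
  proof (rule uniform_limitI)
    fix e :: real assume "0 < e"
    then obtain N where "inverse (real (Suc N)) < e" using reals_Archimedean by blast
    then show "\<forall>\<^sub>F n in sequentially. \<forall>z\<in>spectrum a. dist (poly (p n) z) (f z) < e"
      unfolding eventually_sequentially dist_norm using close by blast
  qed
  have "Cauchy (\<lambda>n. poly_eval a (p n))"
  proof (rule CauchyI)
    fix e :: real assume e: "0 < e"
    then obtain N where N: "inverse (real (Suc N)) < e/3" using reals_Archimedean[of "e/3"] by auto
    have "norm (poly_eval a (p m) - poly_eval a (p n)) < e" if "N \<le> m" "N \<le> n" for m n
    proof -
      have "norm (poly_eval a (p m - p n)) \<le> 2 * (e/3)"
      proof (rule norm_poly_eval_le[OF a])
        fix z assume z: "z \<in> spectrum a"
        have "cmod (poly (p m) z - f z) < e/3" "cmod (poly (p n) z - f z) < e/3"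
          using close[OF z N] that by blast+
        then show "cmod (poly (p m - p n) z) \<le> 2 * (e/3)"
          using norm_triangle_ineq4[of "poly (p m) z - f z" "poly (p n) z - f z"] by simp
      qed (use e in simp)
      then show ?thesis using e by (simp add: poly_eval_diff)
    qed
    then show "\<exists>M. \<forall>m\<ge>M. \<forall>n\<ge>M. norm (poly_eval a (p m) - poly_eval a (p n)) < e" by blast
  qed
  then obtain y where "(\<lambda>n. poly_eval a (p n)) \<longlonglongrightarrow> y"
    using Cauchy_convergent convergent_def by blast
  with u show ?thesis by (auto simp: calculus_value_def)
qed

lemma calculus_value_cong:
  assumes "\<And>z. z \<in> spectrum a \<Longrightarrow> f z = g z"
  shows "calculus_value a f = calculus_value a g"
  using uniform_limit_cong'[of "spectrum a" _ _ f g sequentially] assms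
  by (intro ext) (simp add: calculus_value_def)

lemma calculus_value_poly: "calculus_value a (poly p) (poly_eval a p)"
  unfolding calculus_value_def by (intro exI[of _ "\<lambda>_. p"]) (simp add: uniform_limit_const)

lemma calculus_value_add:
  assumes "calculus_value a f y" "calculus_value a g w"
  shows "calculus_value a (\<lambda>z. f z + g z) (y + w)"
proof -
  obtain p q where p: "uniform_limit (spectrum a) (\<lambda>n. poly (p n)) f sequentially"
      "(\<lambda>n. poly_eval a (p n)) \<longlonglongrightarrow> y"
    and q: "uniform_limit (spectrum a) (\<lambda>n. poly (q n)) g sequentially"
      "(\<lambda>n. poly_eval a (q n)) \<longlonglongrightarrow> w" using assms by (auto simp: calculus_value_def)
  have "uniform_limit (spectrum a) (\<lambda>n z. poly (p n + q n) z) (\<lambda>z. f z + g z) sequentially"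
    unfolding poly_add by (rule uniform_limit_add[OF p(1) q(1)])
  moreover have "(\<lambda>n. poly_eval a (p n + q n)) \<longlonglongrightarrow> y + w"
    unfolding poly_eval_add by (rule tendsto_add[OF p(2) q(2)])
  ultimately show ?thesis unfolding calculus_value_def
    by (intro exI[of _ "\<lambda>n. p n + q n"] conjI)
qed

lemma calculus_value_mult:
  assumes f: "continuous_on (spectrum a) f" and g: "continuous_on (spectrum a) g"
    and "calculus_value a f y" "calculus_value a g w"
  shows "calculus_value a (\<lambda>z. f z * g z) (y * w)"
proof -
  have b: "bounded (f ` spectrum a)" "bounded (g ` spectrum a)"
    using f g by (auto intro: compact_imp_bounded compact_continuous_image compact_spectrum)
  obtain p q where p: "uniform_limit (spectrum a) (\<lambda>n. poly (p n)) f sequentially"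
      "(\<lambda>n. poly_eval a (p n)) \<longlonglongrightarrow> y"
    and q: "uniform_limit (spectrum a) (\<lambda>n. poly (q n)) g sequentially"
      "(\<lambda>n. poly_eval a (q n)) \<longlonglongrightarrow> w" using assms by (auto simp: calculus_value_def)
  have "uniform_limit (spectrum a) (\<lambda>n z. poly (p n * q n) z) (\<lambda>z. f z * g z) sequentially"
    unfolding poly_mult by (rule uniform_lim_mult[OF p(1) q(1) b])
  moreover have "(\<lambda>n. poly_eval a (p n * q n)) \<longlonglongrightarrow> y * w"
    unfolding poly_eval_mult by (rule tendsto_mult[OF p(2) q(2)])
  ultimately show ?thesis unfolding calculus_value_def
    by (intro exI[of _ "\<lambda>n. p n * q n"] conjI)
qed

lemma calculus_value_cnj:
  assumes a: "star a = a" and "calculus_value a f y"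
  shows "calculus_value a (\<lambda>z. cnj (f z)) (star y)"
proof -
  obtain p where p: "uniform_limit (spectrum a) (\<lambda>n. poly (p n)) f sequentially"
    "(\<lambda>n. poly_eval a (p n)) \<longlonglongrightarrow> y" using assms by (auto simp: calculus_value_def)
  have c: "poly (map_poly cnj (p n)) z = cnj (poly (p n) z)" if "z \<in> spectrum a" for n z
  proof -
    have "cnj z = z" using spectrum_selfadjoint_real[OF a that] by (simp add: complex_eq_iff)
    then show ?thesis using poly_cnj[of "p n" z] by simp
  qed
  have "uniform_limit (spectrum a) (\<lambda>n z. cnj (poly (p n) z)) (\<lambda>z. cnj (f z)) sequentially"
    by (rule bounded_linear.uniform_limit[OF bounded_linear_cnj p(1)])
  then have "uniform_limit (spectrum a) (\<lambda>n. poly (map_poly cnj (p n))) (\<lambda>z. cnj (f z)) sequentially"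
    using c by (subst uniform_limit_cong'[where g = "\<lambda>n z. cnj (poly (p n) z)"]) auto
  then show ?thesis unfolding calculus_value_def
    using tendsto_star[OF p(2)] star_poly_eval[OF a]
    by (intro exI[of _ "\<lambda>n. map_poly cnj (p n)"]) simp
qed

text \<open>Exhibiting one homomorphism \<open>\<Phi>\<close> is what makes the choice in
  \<open>continuous_calculus\<close> meaningful.\<close>

lemma continuous_calculus:
  fixes a :: "'b::unital_cstar_algebra"
  assumes a: "star a = a"
  shows "is_continuous_calculus a (continuous_calculus a)"
proof -
  define \<Phi> where "\<Phi> f = (SOME y. calculus_value a f y)" for f
  have val: "calculus_value a f (\<Phi> f)" if "continuous_on (spectrum a) f" for f
    unfolding \<Phi>_def by (rule someI_ex[OF calculus_value_exists[OF a that]])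
  have eq: "\<Phi> f = y" if "calculus_value a f y" for f y
    unfolding \<Phi>_def 
    by (rule some_equality[where P = "calculus_value a f", OF that calculus_value_unique[OF a _ that]])
  have const: "calculus_value a (\<lambda>z. c) (c *\<^sub>C 1)" for c
  proof -
    have "poly [:c:] = (\<lambda>z. c)" by (simp add: fun_eq_iff)
    then show ?thesis using calculus_value_poly[of a "[:c:]"] by simp
  qed
  have "is_continuous_calculus a \<Phi>"
    unfolding is_continuous_calculus_def
  proof (intro conjI allI impI; (elim conjE)?)
    fix f g :: "complex \<Rightarrow> complex"
    assume "\<forall>z\<in>spectrum a. f z = g z"
    then show "\<Phi> f = \<Phi> g" using calculus_value_cong[of a f g] by (simp add: \<Phi>_def)
  next
    fix f g :: "complex \<Rightarrow> complex"
    assume fg: "continuous_on (spectrum a) f" "continuous_on (spectrum a) g"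
    show "\<Phi> (\<lambda>z. f z + g z) = \<Phi> f + \<Phi> g"
      by (intro eq calculus_value_add val fg)
    show "\<Phi> (\<lambda>z. f z * g z) = \<Phi> f * \<Phi> g"
      by (intro eq calculus_value_mult val fg)
  next
    fix c and f :: "complex \<Rightarrow> complex"
    assume f: "continuous_on (spectrum a) f"
    have "\<Phi> (\<lambda>z. c * f z) = c *\<^sub>C 1 * \<Phi> f"
      by (intro eq calculus_value_mult val f const continuous_on_const)
    then show "\<Phi> (\<lambda>z. c * f z) = c *\<^sub>C \<Phi> f" by simp
    show "\<Phi> (\<lambda>z. cnj (f z)) = star (\<Phi> f)"
      by (intro eq calculus_value_cnj a val f)
  next
    show "\<Phi> (\<lambda>z. 1) = 1" using eq[OF const[of 1]] by simp
    have "(\<lambda>z::complex. z) = poly [:0, 1:]" by (simp add: fun_eq_iff)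
    then show "\<Phi> (\<lambda>z. z) = a" using eq[OF calculus_value_poly[of a "[:0, 1:]"]] by simp
  qed
  then show ?thesis unfolding continuous_calculus_def
    by (rule someI[where P = "is_continuous_calculus a"])
qed

section \<open>Positive elements\<close>

context
  fixes a :: "'b::unital_cstar_algebra"
  assumes a: "star a = a"
begin

lemma calculus_cong:
  assumes "continuous_on (spectrum a) f" "\<And>z. z \<in> spectrum a \<Longrightarrow> f z = g z"
  shows "continuous_calculus a f = continuous_calculus a g"
  using continuous_calculus[OF a] assms unfolding is_continuous_calculus_def by blast

lemma calculus_add:
  assumes "continuous_on (spectrum a) f" "continuous_on (spectrum a) g"
  shows "continuous_calculus a (\<lambda>z. f z + g z) = continuous_calculus a f + continuous_calculus a g"
  using continuous_calculus[OF a] assms unfolding is_continuous_calculus_def by blast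

lemma calculus_mult:
  assumes "continuous_on (spectrum a) f" "continuous_on (spectrum a) g"
  shows "continuous_calculus a (\<lambda>z. f z * g z) = continuous_calculus a f * continuous_calculus a g"
  using continuous_calculus[OF a] assms unfolding is_continuous_calculus_def by blast

lemma calculus_scaleC:
  assumes "continuous_on (spectrum a) f"
  shows "continuous_calculus a (\<lambda>z. c * f z) = c *\<^sub>C continuous_calculus a f"
  using continuous_calculus[OF a] assms unfolding is_continuous_calculus_def by blast

lemma calculus_cnj:
  assumes "continuous_on (spectrum a) f"
  shows "continuous_calculus a (\<lambda>z. cnj (f z)) = star (continuous_calculus a f)"
  using continuous_calculus[OF a] assms unfolding is_continuous_calculus_def by blast

lemma calculus_one: "continuous_calculus a (\<lambda>z. 1) = 1"
  using continuous_calculus[OF a] unfolding is_continuous_calculus_def by blast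

lemma calculus_id: "continuous_calculus a (\<lambda>z. z) = a"
  using continuous_calculus[OF a] unfolding is_continuous_calculus_def by blast

lemma calculus_const: "continuous_calculus a (\<lambda>z. c) = c *\<^sub>C 1"
  using calculus_scaleC[of "\<lambda>z. 1" c] by (simp add: calculus_one continuous_on_const)

lemma calculus_invertible:
  assumes f: "continuous_on (spectrum a) f" and nz: "\<And>z. z \<in> spectrum a \<Longrightarrow> f z \<noteq> 0"
  shows "continuous_calculus a f \<in> invertibles UNIV"
proof (rule invertiblesI)
  let ?g = "\<lambda>z. inverse (f z)"
  have g: "continuous_on (spectrum a) ?g" using f nz by (intro continuous_on_inverse) auto
  have "continuous_calculus a (\<lambda>z. f z * ?g z) = continuous_calculus a (\<lambda>z. 1)"
    using nz by (intro calculus_cong continuous_intros f g) auto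
  then show "continuous_calculus a f * continuous_calculus a ?g = 1"
    by (simp add: calculus_mult f g calculus_one)
  have "continuous_calculus a (\<lambda>z. ?g z * f z) = continuous_calculus a (\<lambda>z. 1)"
    using nz by (intro calculus_cong continuous_intros f g) auto
  then show "continuous_calculus a ?g * continuous_calculus a f = 1"
    by (simp add: calculus_mult f g calculus_one)
qed

lemma spectrum_calculus_subset:
  assumes f: "continuous_on (spectrum a) f"
  shows "spectrum (continuous_calculus a f) \<subseteq> f ` spectrum a"
proof
  fix l assume l: "l \<in> spectrum (continuous_calculus a f)"
  have "continuous_calculus a (\<lambda>z. l + (-1) * f z) = l *\<^sub>C 1 + (-1) *\<^sub>C continuous_calculus a f"
    using calculus_add[OF continuous_on_const[of _ l] continuous_on_mult[OF continuous_on_const[of _ "-1"] f]]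
    by (simp only: calculus_const calculus_scaleC[OF f])
  then have "continuous_calculus a (\<lambda>z. l + (-1) * f z) \<notin> invertibles UNIV"
    using l by (simp add: spectrum_def scaleC.minus_left)
  moreover have "continuous_on (spectrum a) (\<lambda>z. l + (-1) * f z)"
    by (intro continuous_intros f)
  ultimately obtain z where "z \<in> spectrum a" "l + (-1) * f z = 0"
    using calculus_invertible by blast
  then show "l \<in> f ` spectrum a" by auto
qed

lemma of_real_Re_spectrum: "z \<in> spectrum a \<Longrightarrow> of_real (Re z) = z"
  using spectrum_selfadjoint_real[OF a] by (simp add: complex_eq_iff)

end

text \<open>Real functions give self-adjoint values, whose norm and positivity can be read off the
  spectrum. The argument \<open>Re z\<close> matches the form used in
  \<open>closed_under_smooth_calculus\<close>.\<close>

definition real_calculus :: "'b::unital_cstar_algebra \<Rightarrow> (real \<Rightarrow> real) \<Rightarrow> 'b" where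
  "real_calculus a g = continuous_calculus a (\<lambda>z. of_real (g (Re z)))"

lemma continuous_on_of_real_Re:
  assumes "continuous_on UNIV (g :: real \<Rightarrow> real)"
  shows "continuous_on S (\<lambda>z. complex_of_real (g (Re z)))"
  by (intro continuous_intros continuous_on_compose2[OF assms]) auto

context
  fixes a :: "'b::unital_cstar_algebra"
  assumes a: "star a = a"
begin

lemma real_calculus_cong:
  assumes "continuous_on UNIV f" "\<And>t. of_real t \<in> spectrum a \<Longrightarrow> f t = g t"
  shows "real_calculus a f = real_calculus a g"
  unfolding real_calculus_def
proof (rule calculus_cong[OF a continuous_on_of_real_Re[OF assms(1)]])
  fix z assume "z \<in> spectrum a"
  then have "f (Re z) = g (Re z)" using assms(2)[of "Re z"] of_real_Re_spectrum[OF a] by simp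
  then show "complex_of_real (f (Re z)) = of_real (g (Re z))" by simp
qed

lemma real_calculus_add:
  assumes "continuous_on UNIV f" "continuous_on UNIV g"
  shows "real_calculus a (\<lambda>t. f t + g t) = real_calculus a f + real_calculus a g"
  using calculus_add[OF a continuous_on_of_real_Re[OF assms(1)] continuous_on_of_real_Re[OF assms(2)]]
  by (simp add: real_calculus_def)

lemma real_calculus_mult:
  assumes "continuous_on UNIV f" "continuous_on UNIV g"
  shows "real_calculus a (\<lambda>t. f t * g t) = real_calculus a f * real_calculus a g"
  using calculus_mult[OF a continuous_on_of_real_Re[OF assms(1)] continuous_on_of_real_Re[OF assms(2)]]
  by (simp add: real_calculus_def)

lemma real_calculus_const: "real_calculus a (\<lambda>t. c) = c *\<^sub>R 1"
  using calculus_const[OF a, of "of_real c"] by (simp add: real_calculus_def scaleR_eq_scaleC)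

lemma real_calculus_scaleR:
  assumes "continuous_on UNIV f"
  shows "real_calculus a (\<lambda>t. c * f t) = c *\<^sub>R real_calculus a f"
  using real_calculus_mult[OF continuous_on_const assms, of c] by (simp add: real_calculus_const)

lemma real_calculus_id: "real_calculus a (\<lambda>t. t) = a"
proof -
  have "real_calculus a (\<lambda>t. t) = continuous_calculus a (\<lambda>z. z)" unfolding real_calculus_def
    by (rule calculus_cong[OF a]) (auto intro: continuous_intros simp: of_real_Re_spectrum[OF a])
  then show ?thesis by (simp add: calculus_id[OF a])
qed

lemma star_real_calculus:
  assumes "continuous_on UNIV f"
  shows "star (real_calculus a f) = real_calculus a f"
  using calculus_cnj[OF a continuous_on_of_real_Re[OF assms]] by (simp add: real_calculus_def)

lemma spectrum_real_calculus:
  assumes "continuous_on UNIV f" "z \<in> spectrum (real_calculus a f)"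
  obtains t where "of_real t \<in> spectrum a" "z = of_real (f t)"
  using spectrum_calculus_subset[OF a continuous_on_of_real_Re[OF assms(1)]] assms(2)
    of_real_Re_spectrum[OF a] unfolding real_calculus_def by (metis (no_types, lifting) imageE subsetD)

lemma real_calculus_invertible:
  assumes "continuous_on UNIV f" "\<And>t. of_real t \<in> spectrum a \<Longrightarrow> f t \<noteq> 0"
  shows "real_calculus a f \<in> invertibles UNIV"
  unfolding real_calculus_def
  by (rule calculus_invertible[OF a continuous_on_of_real_Re[OF assms(1)]])
    (use assms(2) of_real_Re_spectrum[OF a] in auto)

lemma norm_real_calculus_le:
  assumes f: "continuous_on UNIV f" and M: "0 \<le> M" "\<And>t. of_real t \<in> spectrum a \<Longrightarrow> \<bar>f t\<bar> \<le> M"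
  shows "norm (real_calculus a f) \<le> M"
proof (rule norm_le_spectrum_bound[OF star_real_calculus[OF f] M(1)])
  fix z assume "z \<in> spectrum (real_calculus a f)"
  then obtain t where "of_real t \<in> spectrum a" "z = of_real (f t)"
    using spectrum_real_calculus[OF f] by blast
  then show "cmod z \<le> M" using M(2) by simp
qed

end

section \<open>Spectra of shifts and of products\<close>

lemma spectrum_const_minus:
  "z \<in> spectrum (c *\<^sub>C 1 - x) \<longleftrightarrow> c - z \<in> spectrum (x :: 'b::unital_cstar_algebra)"
proof -
  have "z *\<^sub>C 1 - (c *\<^sub>C 1 - x) = (-1) *\<^sub>C ((c - z) *\<^sub>C 1 - x)"
    by (simp add: scaleC.minus_left scaleC.diff_left)
  then show ?thesis by (simp add: spectrum_def invertibles_scaleC_iff)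
qed

lemma spectrum_uminus: "z \<in> spectrum (- x) \<longleftrightarrow> - z \<in> spectrum (x :: 'b::unital_cstar_algebra)"
  using spectrum_const_minus[of z 0 x] by simp

text \<open>Jacobson's formula: if \<open>u\<close> inverts \<open>z - y * x\<close>, then
  \<open>(1 + x * u * y) / z\<close> inverts \<open>z - x * y\<close>.\<close>

lemma spectrum_mult_commute:
  fixes x y :: "'b::unital_cstar_algebra"
  assumes z: "z \<in> spectrum (x * y)" and z0: "z \<noteq> 0"
  shows "z \<in> spectrum (y * x)"
proof (rule ccontr)
  assume "z \<notin> spectrum (y * x)"
  then have inv: "z *\<^sub>C 1 - y * x \<in> invertibles UNIV" by (simp add: spectrum_def)
  define u where "u = alg_inverse (z *\<^sub>C 1 - y * x)"
  have u: "y * x * u = z *\<^sub>C u - 1" "u * (y * x) = z *\<^sub>C u - 1"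
    using alg_inverse[OF inv] by (simp_all add: u_def algebra_simps)
  let ?v = "inverse z *\<^sub>C (1 + x * u * y)"
  have 1: "x * y * (x * u * y) = z *\<^sub>C (x * u * y) - x * y"
  proof -
    have "x * y * (x * u * y) = x * (y * x * u) * y" by (simp only: mult.assoc)
    also have "\<dots> = x * (z *\<^sub>C u - 1) * y" by (simp only: u)
    finally show ?thesis by (simp add: algebra_simps)
  qed
  have 2: "x * u * y * (x * y) = z *\<^sub>C (x * u * y) - x * y"
  proof -
    have "x * u * y * (x * y) = x * (u * (y * x)) * y" by (simp only: mult.assoc)
    also have "\<dots> = x * (z *\<^sub>C u - 1) * y" by (simp only: u)
    finally show ?thesis by (simp add: algebra_simps)
  qed
  have "(z *\<^sub>C 1 - x * y) * (1 + x * u * y) = z *\<^sub>C 1" "(1 + x * u * y) * (z *\<^sub>C 1 - x * y) = z *\<^sub>C 1"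
    using 1 2
    by (simp_all add: scaleC.add_right distrib_left distrib_right left_diff_distrib right_diff_distrib)
  then have "z *\<^sub>C 1 - x * y \<in> invertibles UNIV"
    using z0 by (intro invertiblesI[of _ ?v]) simp_all
  then show False using z by (simp add: spectrum_def)
qed

section \<open>The cone of positive elements\<close>

definition positive :: "'b::unital_cstar_algebra \<Rightarrow> bool" where
  "positive x \<longleftrightarrow> star x = x \<and> (\<forall>t. of_real t \<in> spectrum x \<longrightarrow> 0 \<le> t)"

lemma positive_norm_le:
  assumes x: "positive x" and le: "\<And>t. of_real t \<in> spectrum x \<Longrightarrow> t \<le> M" and "0 \<le> M"
  shows "norm x \<le> M"
proof (rule norm_le_spectrum_bound)
  fix z assume z: "z \<in> spectrum x"
  have "star x = x" using x by (simp add: positive_def)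
  from of_real_Re_spectrum[OF this z] have "of_real (Re z) = z" .
  then show "cmod z \<le> M" using z le[of "Re z"] x unfolding positive_def
    by (metis abs_of_nonneg norm_of_real)
qed (use assms in \<open>auto simp: positive_def\<close>)

text \<open>Together with its converse \<open>norm_diff_le_if_positive\<close>, this trades the
  spectral condition for a norm inequality, to which the triangle inequality applies; sums of
  positive elements are treated that way.\<close>

lemma positive_if_norm_diff_le:
  fixes x :: "'b::unital_cstar_algebra"
  assumes "star x = x" "norm (s *\<^sub>R 1 - x) \<le> s"
  shows "positive x"
  unfolding positive_def
proof (intro conjI allI impI)
  fix t assume "complex_of_real t \<in> spectrum x"
  then have "of_real (s - t) \<in> spectrum (of_real s *\<^sub>C 1 - x)" by (simp add: spectrum_const_minus)
  from spectrum_norm_bound[OF this] show "0 \<le> t"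
    using assms by (simp add: scaleR_eq_scaleC del: of_real_diff)
qed fact

lemma norm_diff_le_if_positive:
  fixes x :: "'b::unital_cstar_algebra"
  assumes x: "positive x" and s: "norm x \<le> s"
  shows "norm (s *\<^sub>R 1 - x) \<le> s"
proof (rule norm_le_spectrum_bound)
  have "star x = x" using x by (simp add: positive_def)
  then show st: "star (s *\<^sub>R 1 - x) = s *\<^sub>R 1 - x"
    by (simp add: star_diff scaleR_eq_scaleC star_scaleC)
  show "0 \<le> s" using s norm_ge_zero order_trans by blast
  fix z assume z: "z \<in> spectrum (s *\<^sub>R 1 - x)"
  then have zr: "of_real (Re z) = z" by (rule of_real_Re_spectrum[OF st])
  then have "of_real (s - Re z) \<in> spectrum x"
    using z by (simp add: scaleR_eq_scaleC spectrum_const_minus)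
  then have "0 \<le> s - Re z" "\<bar>s - Re z\<bar> \<le> norm x"
    using x spectrum_norm_bound[of "of_real (s - Re z)" x] unfolding positive_def norm_of_real by blast+
  then have "\<bar>Re z\<bar> \<le> s" using s by linarith
  then show "cmod z \<le> s" using zr by (metis norm_of_real)
qed

lemma positive_add:
  assumes "positive x" "positive y"
  shows "positive (x + y)"
proof (rule positive_if_norm_diff_le)
  show "star (x + y) = x + y" using assms by (simp add: positive_def star_add)
  have "norm ((norm x + norm y) *\<^sub>R 1 - (x + y)) = norm ((norm x *\<^sub>R 1 - x) + (norm y *\<^sub>R 1 - y))"
    by (simp add: algebra_simps)
  also have "\<dots> \<le> norm (norm x *\<^sub>R 1 - x) + norm (norm y *\<^sub>R 1 - y)" by (rule norm_triangle_ineq)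
  also have "\<dots> \<le> norm x + norm y"
    by (intro add_mono norm_diff_le_if_positive assms order_refl)
  finally show "norm ((norm x + norm y) *\<^sub>R 1 - (x + y)) \<le> norm x + norm y" .
qed

lemma positive_real_calculus:
  assumes "star a = a" "continuous_on UNIV f" "\<And>t. of_real t \<in> spectrum a \<Longrightarrow> 0 \<le> f t"
  shows "positive (real_calculus a f)"
  unfolding positive_def
proof (intro conjI allI impI)
  fix t assume "complex_of_real t \<in> spectrum (real_calculus a f)"
  then obtain s where "of_real s \<in> spectrum a" "complex_of_real t = of_real (f s)"
    using spectrum_real_calculus[OF assms(1,2)] by blast
  then show "0 \<le> t" using assms(3) by simp
qed (rule star_real_calculus[OF assms(1,2)])

lemma positive_square:
  assumes "star a = a"
  shows "positive (a * a)"
proof -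
  have "a * a = real_calculus a (\<lambda>t. t * t)"
    by (simp add: real_calculus_mult[OF assms] real_calculus_id[OF assms])
  then show ?thesis using positive_real_calculus[OF assms, of "\<lambda>t. t * t"]
    by (simp add: continuous_on_mult)
qed

lemma positive_uminus_eq_0:
  assumes "positive x" "positive (- x)"
  shows "x = 0"
proof -
  have "t \<le> 0" if "of_real t \<in> spectrum x" for t
    using assms(2) that unfolding positive_def by (metis neg_0_le_iff_le of_real_minus spectrum_uminus minus_minus)
  then have "norm x \<le> 0" by (intro positive_norm_le assms) auto
  then show ?thesis by simp
qed

text \<open>Writing \<open>z = h + \<i>k\<close> with self-adjoint \<open>h\<close>, \<open>k\<close>, one has \<open>z\<^sup>*z + zz\<^sup>* = 2h\<^sup>2 + 2k\<^sup>2\<close>; the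
  proof uses the multiples \<open>2h\<close> and \<open>2k\<close>.\<close>

lemma eq_0_if_positive_uminus_star_mult:
  fixes z :: "'b::unital_cstar_algebra"
  assumes neg: "positive (- (star z * z))"
  shows "z = 0"
proof -
  \<comment> \<open>The two products \<open>z * star z\<close> and \<open>star z * z\<close> have
    the same nonzero spectrum.\<close>
  have neg': "positive (- (z * star z))"
    unfolding positive_def
  proof (intro conjI allI impI)
    show "star (- (z * star z)) = - (z * star z)" using star_diff[of 0 "z * star z"] by (simp add: star_mult)
    fix t assume t: "complex_of_real t \<in> spectrum (- (z * star z))"
    then have t': "- complex_of_real t \<in> spectrum (z * star z)" by (simp add: spectrum_uminus)
    show "0 \<le> t"
    proof (cases "t = 0")
      case False
      then have "- complex_of_real t \<in> spectrum (star z * z)"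
        using spectrum_mult_commute[OF t'] by simp
      then show ?thesis using neg by (simp add: spectrum_uminus positive_def)
    qed simp
  qed
  let ?h = "z + star z" and ?k = "\<i> *\<^sub>C (star z - z)"
  have h: "positive (?h * ?h)" by (rule positive_square) (simp add: star_add add.commute)
  have k: "positive (?k * ?k)"
    by (rule positive_square) (simp add: star_scaleC star_diff scaleC.minus_left scaleC.diff_right)
  \<comment> \<open>The squares add up to \<open>2 * (star z * z + z * star z)\<close>. What remains
    after the subtractions exhibits \<open>star z * z\<close> as a sum of positive elements.\<close>
  have "?h * ?h + ?k * ?k + - (z * star z) + - (z * star z) + - (star z * z) = star z * z"
    by (simp add: scaleC.minus_left scaleC.diff_right algebra_simps)
  then have "positive (star z * z)" using positive_add h k neg neg' by metis
  then have "star z * z = 0" using neg by (rule positive_uminus_eq_0)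
  then show ?thesis using cstar_identity[of z] by simp
qed

text \<open>Let \<open>c\<close> be the negative part of \<open>w = star y * y\<close>. Then
  \<open>star (y * c) * (y * c) = c * w * c\<close> is minus the cube of \<open>c\<close>, so
  \<open>y * c = 0\<close> by the preceding lemma. Hence \<open>c = 0\<close>, and \<open>w\<close>
  equals its positive part.\<close>

lemma positive_star_mult: "positive (star y * y)" for y :: "'b::unital_cstar_algebra"
proof -
  define w where "w = star y * y"
  have w: "star w = w" by (simp add: w_def star_mult)
  define n :: "real \<Rightarrow> real" where "n t = max (- t) 0" for t
  have n: "continuous_on UNIV n" unfolding n_def by (intro continuous_intros)
  define c where "c = real_calculus w n"
  have c: "star c = c" unfolding c_def by (rule star_real_calculus[OF w n])
  have "star (y * c) * (y * c) = c * w * c" by (simp add: star_mult c w_def mult.assoc)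
  also have "\<dots> = real_calculus w (\<lambda>t. n t * t * n t)"
    by (simp add: real_calculus_mult[OF w] real_calculus_id[OF w] n c_def continuous_on_mult)
  finally have cwc: "star (y * c) * (y * c) = real_calculus w (\<lambda>t. n t * t * n t)" .
  have cont: "continuous_on UNIV (\<lambda>t. n t * t * n t)" by (intro continuous_intros n)
  have "- (star (y * c) * (y * c)) = real_calculus w (\<lambda>t. (-1) * (n t * t * n t))"
    unfolding cwc real_calculus_scaleR[OF w cont] by simp
  moreover have "positive (real_calculus w (\<lambda>t. (-1) * (n t * t * n t)))"
    by (rule positive_real_calculus[OF w continuous_on_mult[OF continuous_on_const cont]])
      (auto simp: n_def max_def mult_nonneg_nonpos mult_nonneg_nonneg mult_nonpos_nonpos)
  ultimately have "y * c = 0" by (intro eq_0_if_positive_uminus_star_mult) simp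
  then have "real_calculus w (\<lambda>t. n t * t * n t) = 0" using cwc by simp
  \<comment> \<open>One more factor \<open>c\<close> turns the cube into a fourth power, whose norm
    two uses of the C*-identity compute.\<close>
  then have "real_calculus w (\<lambda>t. (-1) * (n t * t * n t)) * c = 0"
    unfolding real_calculus_scaleR[OF w cont] by simp
  also have "real_calculus w (\<lambda>t. (-1) * (n t * t * n t)) = real_calculus w (\<lambda>t. n t * n t * n t)"
    by (rule real_calculus_cong[OF w continuous_on_mult[OF continuous_on_const cont]])
      (simp add: n_def max_def)
  also have "\<dots> * c = (c * c) * (c * c)"
    by (simp add: real_calculus_mult[OF w] n c_def continuous_on_mult mult.assoc)
  finally have "norm ((c * c) * (c * c)) = 0" by simp
  then have "c = 0" using norm_power2_selfadjoint[OF c] norm_power2_selfadjoint[of "c * c"]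
    by (simp add: star_mult c)
  define p :: "real \<Rightarrow> real" where "p t = max t 0" for t
  have p: "continuous_on UNIV p" unfolding p_def by (intro continuous_intros)
  have "(\<lambda>t. p t + (-1) * n t) = (\<lambda>t. t)" by (auto simp: fun_eq_iff p_def n_def max_def)
  then have "w = real_calculus w (\<lambda>t. p t + (-1) * n t)" using real_calculus_id[OF w] by simp
  also have "\<dots> = real_calculus w p + (-1) *\<^sub>R c"
    by (simp only: real_calculus_add[OF w p continuous_on_mult[OF continuous_on_const n]]
        real_calculus_scaleR[OF w n] c_def)
  finally have "w = real_calculus w p" using \<open>c = 0\<close> by simp
  moreover have "positive (real_calculus w p)"
    by (rule positive_real_calculus[OF w p]) (simp add: p_def)
  ultimately show ?thesis by (simp add: w_def)
qed

text \<open>\<open>s - p = (s - (p + q)) + q\<close> with \<open>s = norm (p + q)\<close> is a sum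
  of positive elements, so the spectrum of \<open>p\<close> stays below \<open>s\<close>.\<close>

lemma positive_norm_mono:
  fixes p q :: "'b::unital_cstar_algebra"
  assumes p: "positive p" and q: "positive q"
  shows "norm p \<le> norm (p + q)"
proof (rule positive_norm_le[OF p])
  let ?s = "norm (p + q)"
  have pq: "positive (p + q)" by (rule positive_add[OF p q])
  have "positive (?s *\<^sub>R 1 - (p + q))"
  proof (rule positive_if_norm_diff_le)
    show "star (?s *\<^sub>R 1 - (p + q)) = ?s *\<^sub>R 1 - (p + q)"
      using pq by (simp add: positive_def star_diff scaleR_eq_scaleC star_scaleC)
    show "norm (?s *\<^sub>R 1 - (?s *\<^sub>R 1 - (p + q))) \<le> ?s" by (simp add: add.commute)
  qed
  from positive_add[OF this q] have r: "positive (?s *\<^sub>R 1 - p)" by (simp add: algebra_simps)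
  fix t assume "complex_of_real t \<in> spectrum p"
  then have "of_real (?s - t) \<in> spectrum (?s *\<^sub>R 1 - p)"
    by (simp add: scaleR_eq_scaleC spectrum_const_minus)
  then have "0 \<le> ?s - t" using r unfolding positive_def by blast
  then show "t \<le> ?s" by simp
qed simp

lemma positive_0 [simp]: "positive (0 :: 'b::unital_cstar_algebra)"
  using positive_star_mult[of 0] by simp

lemma positive_sum:
  "(\<And>i. i \<in> I \<Longrightarrow> positive (x i)) \<Longrightarrow> positive (\<Sum>i\<in>I. x i)"
  by (induction I rule: infinite_finite_induct) (auto intro: positive_add)

lemma norm_le_sum_star_mult:
  fixes y :: "'i \<Rightarrow> 'b::unital_cstar_algebra"
  assumes "finite I" "i \<in> I"
  shows "(norm (y i))\<^sup>2 \<le> norm (\<Sum>j\<in>I. star (y j) * y j)"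
proof -
  have "norm (star (y i) * y i) \<le> norm (star (y i) * y i + (\<Sum>j\<in>I - {i}. star (y j) * y j))"
    by (intro positive_norm_mono positive_star_mult positive_sum)
  then show ?thesis using assms by (simp add: cstar_identity sum.remove)
qed

section \<open>A smooth function that is flat at the origin\<close>

text \<open>The polynomial factor closes the family under differentiation: with
  \<open>u = 1/s\<close>, the derivative of \<open>p(u) exp(-u)\<close> in \<open>s\<close> is
  \<open>u\<^sup>2 (p - p')(u) exp(-u)\<close>.\<close>

definition flat_exp :: "real poly \<Rightarrow> real \<Rightarrow> real" where
  "flat_exp p s = (if s > 0 then poly p (inverse s) * exp (- inverse s) else 0)"

lemma poly_exp_minus_tendsto_0: "((\<lambda>u::real. poly p u * exp (- u)) \<longlongrightarrow> 0) at_top"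
proof -
  have "((\<lambda>u::real. \<Sum>i\<le>degree p. coeff p i * (u ^ i / exp u)) \<longlongrightarrow> 0) at_top"
    by (intro tendsto_null_sum tendsto_mult_right_zero tendsto_power_div_exp_0)
  moreover have "(\<Sum>i\<le>degree p. coeff p i * (u ^ i / exp u)) = poly p u * exp (- u)" for u :: real
    by (simp add: poly_altdef exp_minus sum_distrib_right divide_inverse mult.assoc)
  ultimately show ?thesis by simp
qed

lemma flat_exp_tendsto_0: "(flat_exp p \<longlongrightarrow> 0) (at 0)"
proof -
  have "((\<lambda>s. poly p (inverse s) * exp (- inverse s)) \<longlongrightarrow> 0) (at_right (0::real))"
    by (rule filterlim_compose[OF poly_exp_minus_tendsto_0 filterlim_inverse_at_top_right])
  moreover have "\<forall>\<^sub>F s in at_right 0. poly p (inverse s) * exp (- inverse s) = flat_exp p s"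
    by (auto simp: eventually_at_filter flat_exp_def)
  ultimately have "(flat_exp p \<longlongrightarrow> 0) (at_right 0)" by (rule Lim_transform_eventually)
  moreover have "(flat_exp p \<longlongrightarrow> 0) (at_left 0)"
    by (rule tendsto_eventually) (auto simp: eventually_at_filter flat_exp_def)
  ultimately show ?thesis by (simp add: filterlim_at_split)
qed

lemma flat_exp_has_derivative:
  "(flat_exp p has_real_derivative flat_exp ([:0, 0, 1:] * (p - pderiv p)) s) (at s)"
proof -
  consider "s > 0" | "s < 0" | "s = 0" by linarith
  then show ?thesis
  proof cases
    case 1
    have "((\<lambda>s. poly p (inverse s) * exp (- inverse s)) has_real_derivative
        flat_exp ([:0, 0, 1:] * (p - pderiv p)) s) (at s)"
      using 1 by (auto intro!: derivative_eq_intros DERIV_chain2[OF poly_DERIV]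
        simp: flat_exp_def field_simps power2_eq_square)
    then show ?thesis
      by (rule has_field_derivative_transform_within_open[where S = "{0<..}"])
        (use 1 in \<open>auto simp: flat_exp_def\<close>)
  next
    case 2
    have "((\<lambda>s. 0) has_real_derivative flat_exp ([:0, 0, 1:] * (p - pderiv p)) s) (at s)"
      using 2 by (simp add: flat_exp_def)
    then show ?thesis
      by (rule has_field_derivative_transform_within_open[where S = "{..<0}"])
        (use 2 in \<open>auto simp: flat_exp_def\<close>)
  next
    case 3
    \<comment> \<open>At the origin the difference quotient is itself in the family, with one more
      factor \<open>1/h\<close>, so its limit is known.\<close>
    have "flat_exp (pCons 0 p) = (\<lambda>h. (flat_exp p (0 + h) - flat_exp p 0) / h)"
      by (auto simp: fun_eq_iff flat_exp_def field_simps)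
    then show ?thesis using flat_exp_tendsto_0[of "pCons 0 p"] 3
      by (simp add: DERIV_def flat_exp_def)
  qed
qed

lemma smooth_flat_exp:
  "smooth_on_real UNIV (\<lambda>t. complex_of_real (flat_exp p (e - t)))"
proof -
  \<comment> \<open>\<open>R k\<close> belongs to the \<open>k\<close>-th derivative; the minus sign
    comes from the inner function \<open>e - t\<close>.\<close>
  define R where "R = (\<lambda>k. ((\<lambda>p. - ([:0, 0, 1:] * (p - pderiv p))) ^^ k) p)"
  have R: "R 0 = p" "R (Suc k) = - ([:0, 0, 1:] * (R k - pderiv (R k)))" for k
    by (simp_all add: R_def)
  have minus: "flat_exp (- q) s = - flat_exp q s" for q s by (simp add: flat_exp_def)
  have "((\<lambda>t. flat_exp (R k) (e - t)) has_real_derivative flat_exp (R (Suc k)) (e - t)) (at t)" for k t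
  proof -
    have "((\<lambda>t. e - t) has_real_derivative -1) (at t)" by (auto intro!: derivative_eq_intros)
    from DERIV_chain2[OF flat_exp_has_derivative this] show ?thesis unfolding R(2) minus by simp
  qed
  then have "((\<lambda>t. complex_of_real (flat_exp (R k) (e - t))) has_vector_derivative
      complex_of_real (flat_exp (R (Suc k)) (e - t))) (at t)" for k t
    by (intro has_vector_derivative_of_real)
  then show ?thesis unfolding smooth_on_real_def
    by (intro exI[of _ "\<lambda>k t. complex_of_real (flat_exp (R k) (e - t))"]) (simp add: R(1))
qed

lemma continuous_flat_exp: "continuous_on S (flat_exp p)"
  by (intro continuous_at_imp_continuous_on ballI DERIV_isCont[OF flat_exp_has_derivative])

section \<open>Stable rank\<close>

lemma unital_star_subalgebra_UNIV: "unital_star_subalgebra (UNIV :: 'b::unital_cstar_algebra set)"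
  by (simp add: unital_star_subalgebra_def)

lemma subalgebra_zero: "unital_star_subalgebra A \<Longrightarrow> 0 \<in> A"
  unfolding unital_star_subalgebra_def by (metis scaleC.zero_left)

lemma subalgebra_sum:
  assumes "unital_star_subalgebra A" "\<And>i. i \<in> I \<Longrightarrow> x i \<in> A"
  shows "(\<Sum>i\<in>I. x i) \<in> A"
  using assms(2) subalgebra_zero[OF assms(1)] assms(1)
  by (induction I rule: infinite_finite_induct) (auto simp: unital_star_subalgebra_def)

lemma Lg_iff:
  assumes A: "unital_star_subalgebra A"
  shows "a \<in> Lg n A \<longleftrightarrow> (\<forall>i<n. a i \<in> A) \<and> (\<exists>x. (\<forall>i<n. x i \<in> A) \<and> (\<Sum>i<n. x i * a i) = 1)"
proof safe
  assume a: "a \<in> Lg n A"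
  then show "a i \<in> A" if "i < n" for i using that by (simp add: Lg_def)
  have "1 \<in> {\<Sum>i<n. x i * a i |x. \<forall>i<n. x i \<in> A}"
    using a A by (simp add: Lg_def unital_star_subalgebra_def)
  then show "\<exists>x. (\<forall>i<n. x i \<in> A) \<and> (\<Sum>i<n. x i * a i) = 1" by force
next
  fix x assume a: "\<forall>i<n. a i \<in> A" and x: "\<forall>i<n. x i \<in> A" "(\<Sum>i<n. x i * a i) = 1"
  have mult: "u * v \<in> A" if "u \<in> A" "v \<in> A" for u v
    using that A by (simp add: unital_star_subalgebra_def)
  have "{\<Sum>i<n. x i * a i |x. \<forall>i<n. x i \<in> A} = A"
  proof (intro subset_antisym subsetI)
    fix y assume "y \<in> {\<Sum>i<n. x i * a i |x. \<forall>i<n. x i \<in> A}"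
    then show "y \<in> A" using a by (auto intro!: subalgebra_sum[OF A] mult)
  next
    fix y assume y: "y \<in> A"
    have "y = (\<Sum>i<n. (y * x i) * a i)"
      using x(2) by (simp add: mult.assoc flip: sum_distrib_left)
    then show "y \<in> {\<Sum>i<n. x i * a i |x. \<forall>i<n. x i \<in> A}"
      using x(1) y mult by (intro CollectI exI[of _ "\<lambda>i. y * x i"]) auto
  qed
  then show "a \<in> Lg n A" using a by (simp add: Lg_def)
qed

lemmas Lg_UNIV_iff = Lg_iff[OF unital_star_subalgebra_UNIV, simplified]

text \<open>A combination merely close to \<open>1\<close> certifies unimodularity, which is what
  makes it stable under perturbation.\<close>

lemma Lg_UNIV_if_invertible:
  fixes a :: "nat \<Rightarrow> 'b::unital_cstar_algebra"
  assumes "(\<Sum>i<n. x i * a i) \<in> invertibles UNIV"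
  shows "a \<in> Lg n UNIV"
  unfolding Lg_UNIV_iff
  by (rule exI[of _ "\<lambda>i. alg_inverse (\<Sum>i<n. x i * a i) * x i"])
    (simp add: mult.assoc alg_inverse(2)[OF assms] flip: sum_distrib_left)

lemma dense_approx:
  fixes x :: "'i \<Rightarrow> 'b::real_normed_vector"
  assumes "closure A = UNIV"
  obtains X where "\<And>k i. X k i \<in> A" "\<And>i. (\<lambda>k. X k i) \<longlonglongrightarrow> x i"
proof -
  have "\<forall>i. \<exists>f. (\<forall>k. f k \<in> A) \<and> f \<longlonglongrightarrow> x i"
    using assms closure_sequential[of _ A] by blast
  then obtain f where "\<And>i k. f i k \<in> A" "\<And>i. f i \<longlonglongrightarrow> x i" by metis
  then show ?thesis by (intro that[of "\<lambda>k i. f i k"]) auto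
qed

lemma eventually_invertible:
  assumes "s \<longlonglongrightarrow> (1 :: 'b::unital_cstar_algebra)"
  shows "\<exists>k. s k \<in> invertibles UNIV"
proof -
  have "\<forall>\<^sub>F k in sequentially. norm (s k - 1) < 1"
    using tendstoD[OF assms, of 1] by (simp add: dist_norm)
  then show ?thesis
    using invertible_near_one eventually_happens'[OF sequentially_bot] by blast
qed

text \<open>The property of \<open>n\<close> minimised in \<open>Bsr\<close>; the ranks agree
  because it is equivalent for \<open>A\<close> and \<open>UNIV\<close> at each
  \<open>n\<close>.\<close>

definition Bass_condition :: "nat \<Rightarrow> 'b::ring set \<Rightarrow> bool" where
  "Bass_condition n A \<longleftrightarrow>
     (\<forall>a \<in> Lg (Suc n) A. \<exists>c. (\<forall>i<n. c i \<in> A) \<and> (\<lambda>i. a i + c i * a n) \<in> Lg n A)"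

locale dense_full_subalgebra =
  fixes A :: "'b::unital_cstar_algebra set"
  assumes sub: "unital_star_subalgebra A"
    and dense: "closure A = UNIV"
    and full: "full_subalgebra A"
begin

lemma mult_mem: "x \<in> A \<Longrightarrow> y \<in> A \<Longrightarrow> x * y \<in> A"
  and add_mem: "x \<in> A \<Longrightarrow> y \<in> A \<Longrightarrow> x + y \<in> A"
  and star_mem: "x \<in> A \<Longrightarrow> star x \<in> A"
  using sub by (simp_all add: unital_star_subalgebra_def)

lemma alg_inverse_mem:
  assumes "u \<in> A" "u \<in> invertibles UNIV"
  shows "alg_inverse u \<in> A"
  using full assms alg_inverse_unique unfolding full_subalgebra_def invertibles_def by blast

text \<open>Coefficients over the big algebra are approximated from \<open>A\<close>. The resulting
  combination lies in \<open>A\<close> and is invertible, and fullness puts its inverse into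
  \<open>A\<close>.\<close>

lemma Lg_iff_UNIV: "a \<in> Lg n A \<longleftrightarrow> (\<forall>i<n. a i \<in> A) \<and> a \<in> Lg n UNIV"
proof safe
  assume "a \<in> Lg n A"
  then show "a i \<in> A" if "i < n" for i using that by (simp add: Lg_def)
  show "a \<in> Lg n UNIV" using \<open>a \<in> Lg n A\<close> unfolding Lg_iff[OF sub] Lg_UNIV_iff by blast
next
  assume a: "\<forall>i<n. a i \<in> A" and "a \<in> Lg n UNIV"
  then obtain x where x: "(\<Sum>i<n. x i * a i) = 1" by (auto simp: Lg_UNIV_iff)
  obtain X where X: "\<And>k i. X k i \<in> A" "\<And>i. (\<lambda>k. X k i) \<longlonglongrightarrow> x i"
    using dense_approx[OF dense, of x] by blast
  have "(\<lambda>k. \<Sum>i<n. X k i * a i) \<longlonglongrightarrow> 1"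
    unfolding x[symmetric] by (intro tendsto_sum tendsto_mult X(2) tendsto_const)
  then obtain k where k: "(\<Sum>i<n. X k i * a i) \<in> invertibles UNIV" using eventually_invertible by blast
  let ?u = "\<Sum>i<n. X k i * a i"
  have "?u \<in> A" using a X(1) by (intro subalgebra_sum[OF sub] mult_mem) auto
  then have "alg_inverse ?u \<in> A" using k by (rule alg_inverse_mem)
  moreover have "(\<Sum>i<n. (alg_inverse ?u * X k i) * a i) = 1"
    by (simp add: mult.assoc alg_inverse(2)[OF k] flip: sum_distrib_left)
  ultimately show "a \<in> Lg n A" unfolding Lg_iff[OF sub] using a X(1)
    by (intro conjI exI[of _ "\<lambda>i. alg_inverse ?u * X k i"]) (auto intro: mult_mem)
qed

lemma Bass_condition_subalgebra:
  assumes B: "Bass_condition n (UNIV :: 'b set)"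
  shows "Bass_condition n A"
  unfolding Bass_condition_def
proof
  fix a assume a: "a \<in> Lg (Suc n) A"
  then have aA: "a i \<in> A" if "i \<le> n" for i using that by (simp add: Lg_def)
  have "a \<in> Lg (Suc n) UNIV" using a by (simp add: Lg_iff_UNIV)
  then obtain c where "(\<lambda>i. a i + c i * a n) \<in> Lg n UNIV"
    using B unfolding Bass_condition_def by blast
  then obtain x where x: "(\<Sum>i<n. x i * (a i + c i * a n)) = 1" by (auto simp: Lg_UNIV_iff)
  obtain C where C: "\<And>k i. C k i \<in> A" "\<And>i. (\<lambda>k. C k i) \<longlonglongrightarrow> c i"
    using dense_approx[OF dense, of c] by blast
  \<comment> \<open>Only \<open>c\<close> is moved into \<open>A\<close>. The coefficients
    \<open>x i\<close> may stay outside, since by \<open>Lg_iff_UNIV\<close> unimodularity can be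
    tested in the big algebra.\<close>
  have "(\<lambda>k. \<Sum>i<n. x i * (a i + C k i * a n)) \<longlonglongrightarrow> 1"
    unfolding x[symmetric] by (intro tendsto_sum tendsto_mult tendsto_add C(2) tendsto_const)
  then obtain k where "(\<Sum>i<n. x i * (a i + C k i * a n)) \<in> invertibles UNIV"
    using eventually_invertible by blast
  then have "(\<lambda>i. a i + C k i * a n) \<in> Lg n UNIV" by (rule Lg_UNIV_if_invertible)
  then have "(\<lambda>i. a i + C k i * a n) \<in> Lg n A"
    using aA C(1) by (auto simp: Lg_iff_UNIV intro!: add_mem mult_mem)
  then show "\<exists>c. (\<forall>i<n. c i \<in> A) \<and> (\<lambda>i. a i + c i * a n) \<in> Lg n A" using C(1) by blast
qed

end

locale smooth_subalgebra = dense_full_subalgebra A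
  for A :: "'b::unital_cstar_algebra set" +
  assumes smooth: "closed_under_smooth_calculus A"
begin

lemma real_calculus_flat_exp_mem:
  assumes "x \<in> A" "star x = x"
  shows "real_calculus x (\<lambda>t. flat_exp p (e - t)) \<in> A"
proof -
  have "spectrum x \<subseteq> complex_of_real ` UNIV"
    using of_real_Re_spectrum[OF assms(2)] by (metis rangeI subsetI)
  then show ?thesis using smooth assms smooth_flat_exp[of p e] open_UNIV
    unfolding closed_under_smooth_calculus_def real_calculus_def by blast
qed

text \<open>The argument of Herman and Vaserstein.  For \<open>x = \<Sum> b\<^sub>i\<^sup>* b\<^sub>i\<close> and \<open>f > 0\<close> exactly on \<open>(-\<infinity>, \<eta>)\<close>, the
  tuple \<open>(b, f(x))\<close> is left unimodular, hence so are \<open>b + c f(x)\<close> for some \<open>c\<close> and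
  \<open>(b + c f(x)) (\<psi>(x) + \<delta>)\<close>.  Since \<open>f \<psi> = 0\<close>, the latter tends to \<open>b \<psi>(x)\<close> as \<open>\<delta> \<rightarrow> 0\<close>, which is close
  to \<open>b\<close> because \<open>(1 - \<psi>)\<^sup>2 t\<close> is small.\<close>

lemma Lg_approx_subalgebra:
  assumes Bass: "Bass_condition n A" and b: "\<And>i. i < n \<Longrightarrow> b i \<in> A" and e: "0 < e"
  shows "\<exists>d \<in> Lg n UNIV. \<forall>i<n. norm (d i - b i) < e"
proof -
  define x where "x = (\<Sum>i<n. star (b i) * b i)"
  \<comment> \<open>Chosen so that \<open>2 * \<eta>\<close>, the bound for
    \<open>(1 - \<psi>)\<^sup>2 t\<close> on the spectrum, is
    \<open>(e / 2)\<^sup>2\<close>.\<close>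
  define \<eta> where "\<eta> = e\<^sup>2 / 8"
  have \<eta>: "0 < \<eta>" using e by (simp add: \<eta>_def)
  have xA: "x \<in> A" unfolding x_def using b by (intro subalgebra_sum[OF sub] mult_mem star_mem) auto
  have pos: "positive x" unfolding x_def by (intro positive_sum positive_star_mult)
  then have x: "star x = x" by (simp add: positive_def)
  have x_nonneg: "0 \<le> t" if "of_real t \<in> spectrum x" for t using pos that by (simp add: positive_def)
  define f where "f t = flat_exp 1 (\<eta> - t)" for t
  have f: "continuous_on UNIV f" unfolding f_def
    by (intro continuous_on_compose2[OF continuous_flat_exp[of UNIV]] continuous_intros) auto
  define y where "y = real_calculus x f"
  have yA: "y \<in> A" unfolding y_def f_def by (rule real_calculus_flat_exp_mem[OF xA x])
  define a where "a i = (if i < n then b i else y)" for i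
  \<comment> \<open>The coefficients \<open>star (b i)\<close> and \<open>1\<close> give
    \<open>x + f(x)\<close>, where one summand is positive whenever the other vanishes.\<close>
  have "(\<Sum>i<Suc n. (if i < n then star (b i) else 1) * a i) = x + y"
    by (simp add: x_def a_def)
  also have "\<dots> = real_calculus x (\<lambda>t. t + f t)"
    by (simp add: real_calculus_add[OF x] real_calculus_id[OF x] f y_def)
  also have "\<dots> \<in> invertibles UNIV"
  proof (rule real_calculus_invertible[OF x])
    fix t assume "complex_of_real t \<in> spectrum x"
    then have t: "0 \<le> t" by (rule x_nonneg)
    have "0 < t + f t"
    proof (cases "t < \<eta>")
      case True
      then have "0 < f t" by (simp add: f_def flat_exp_def)
      with t show ?thesis by simp
    qed (use \<eta> in \<open>simp add: f_def flat_exp_def\<close>)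
    then show "t + f t \<noteq> 0" by simp
  qed (intro continuous_intros f)
  finally have "a \<in> Lg (Suc n) UNIV" by (rule Lg_UNIV_if_invertible)
  then have "a \<in> Lg (Suc n) A" using b yA by (simp add: Lg_iff_UNIV a_def)
  then obtain c where "(\<lambda>i. a i + c i * a n) \<in> Lg n A" using Bass unfolding Bass_condition_def by blast
  then obtain z where "(\<Sum>i<n. z i * (a i + c i * a n)) = 1"
    unfolding Lg_iff_UNIV Lg_UNIV_iff by blast
  then have z: "(\<Sum>i<n. z i * (b i + c i * y)) = 1" by (simp add: a_def)
  \<comment> \<open>A ramp from \<open>0\<close> at \<open>\<eta>\<close>, where \<open>f\<close>
    ends, to \<open>1\<close> at \<open>2 * \<eta>\<close>.\<close>
  define \<psi> where "\<psi> t = min 1 (max 0 ((t - \<eta>) / \<eta>))" for t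
  have \<psi>: "continuous_on UNIV \<psi>" unfolding \<psi>_def using \<eta> by (intro continuous_intros) auto
  define P where "P = real_calculus x \<psi>"
  have "y * P = real_calculus x (\<lambda>t. f t * \<psi> t)"
    by (simp add: y_def P_def real_calculus_mult[OF x] f \<psi>)
  also have "(\<lambda>t. f t * \<psi> t) = (\<lambda>t. 0)"
    using \<eta> by (auto simp: fun_eq_iff f_def \<psi>_def flat_exp_def divide_nonpos_pos max.absorb1)
  finally have yP: "y * P = 0" by (simp add: real_calculus_const[OF x])
  have bP: "norm (b i * P - b i) \<le> e / 2" if i: "i < n" for i
  proof -
    have Q: "continuous_on UNIV (\<lambda>t. \<psi> t + (-1))" by (intro continuous_intros \<psi>)
    have Pm: "P - 1 = real_calculus x (\<lambda>t. \<psi> t + (-1))"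
      using real_calculus_add[OF x \<psi> continuous_on_const, of "-1"]
      by (simp add: P_def real_calculus_const[OF x])
    then have sP: "star (P - 1) = P - 1" using star_real_calculus[OF x Q] by simp
    \<comment> \<open>Summing over all \<open>j\<close> produces a function of \<open>x\<close>
      alone; \<open>norm_le_sum_star_mult\<close> then recovers the single index
      \<open>i\<close>.\<close>
    have "(\<Sum>j<n. star (b j * (P - 1)) * (b j * (P - 1))) = (P - 1) * x * (P - 1)"
      by (simp add: x_def star_mult sP sum_distrib_left sum_distrib_right mult.assoc)
    also have "\<dots> = real_calculus x (\<lambda>t. (\<psi> t + (-1)) * t * (\<psi> t + (-1)))"
      unfolding Pm by (simp add: real_calculus_mult[OF x] real_calculus_id[OF x] continuous_on_mult
          continuous_on_diff \<psi>)
    also have "norm \<dots> \<le> 2 * \<eta>"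
    proof (rule norm_real_calculus_le[OF x])
      fix t assume "complex_of_real t \<in> spectrum x"
      then have t: "0 \<le> t" by (rule x_nonneg)
      show "\<bar>(\<psi> t + (-1)) * t * (\<psi> t + (-1))\<bar> \<le> 2 * \<eta>"
      proof (cases "t \<le> 2 * \<eta>")
        case True
        have "\<bar>\<psi> t + (-1)\<bar> \<le> 1" by (auto simp: \<psi>_def)
        then have "\<bar>\<psi> t + (-1)\<bar> * t * \<bar>\<psi> t + (-1)\<bar> \<le> 1 * t * 1"
          using t by (intro mult_mono) auto
        then show ?thesis using True t by (simp add: abs_mult)
      next
        case False
        then have "\<psi> t = 1" using \<eta> by (simp add: \<psi>_def)
        then show ?thesis using \<eta> by simp
      qed
    qed (use \<eta> in \<open>auto intro!: continuous_intros \<psi>\<close>)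
    finally have "(norm (b i * (P - 1)))\<^sup>2 \<le> 2 * \<eta>"
      using norm_le_sum_star_mult[of "{..<n}" i "\<lambda>j. b j * (P - 1)"] i by simp
    also have "2 * \<eta> = (e / 2)\<^sup>2" by (simp add: \<eta>_def power_divide)
    finally have "norm (b i * (P - 1)) \<le> e / 2"
      by (rule power2_le_imp_le) (use e in simp)
    then show ?thesis by (simp add: right_diff_distrib)
  qed
  define K where "K = 1 + (\<Sum>i<n. norm (b i + c i * y))"
  have K: "norm (b i + c i * y) < K" if "i < n" for i
    using member_le_sum[of i "{..<n}" "\<lambda>i. norm (b i + c i * y)"] that by (simp add: K_def)
  have K0: "0 < K" unfolding K_def by (intro add_pos_nonneg sum_nonneg) auto
  \<comment> \<open>The contribution \<open>\<delta> * K\<close> of the shift is the other half of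
    \<open>e\<close>.\<close>
  define \<delta> where "\<delta> = e / (2 * K)"
  have \<delta>: "0 < \<delta>" using e K0 by (simp add: \<delta>_def)
  \<comment> \<open>\<open>\<psi>\<close> has zeros, so \<open>P\<close> may fail to be invertible;
    the shift makes the function strictly positive.\<close>
  define H where "H = P + \<delta> *\<^sub>R 1"
  have "H = real_calculus x (\<lambda>t. \<psi> t + \<delta>)"
    using real_calculus_add[OF x \<psi> continuous_on_const, of \<delta>]
    by (simp add: H_def P_def real_calculus_const[OF x])
  also have "\<dots> \<in> invertibles UNIV"
  proof (rule real_calculus_invertible[OF x])
    show "\<psi> t + \<delta> \<noteq> 0" for t using \<delta> by (simp add: \<psi>_def add_nonneg_eq_0_iff)
  qed (intro continuous_intros \<psi>)
  finally have H: "H \<in> invertibles UNIV" .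
  have "(\<Sum>i<n. z i * ((b i + c i * y) * H)) = H"
    using z by (simp flip: mult.assoc sum_distrib_right)
  then have L: "(\<lambda>i. (b i + c i * y) * H) \<in> Lg n UNIV"
    using H by (intro Lg_UNIV_if_invertible[where x = z]) simp
  have N: "norm ((b i + c i * y) * H - b i) < e" if i: "i < n" for i
  proof -
    have "c i * y * P = 0" using yP by (simp add: mult.assoc)
    then have "(b i + c i * y) * H - b i = (b i * P - b i) + \<delta> *\<^sub>R (b i + c i * y)"
      by (simp add: H_def algebra_simps)
    also have "norm \<dots> \<le> norm (b i * P - b i) + \<delta> * norm (b i + c i * y)"
      using norm_triangle_ineq[of "b i * P - b i" "\<delta> *\<^sub>R (b i + c i * y)"] \<delta> by simp
    also have "\<dots> < e / 2 + \<delta> * K"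
      using bP[OF i] K[OF i] \<delta> by (intro add_le_less_mono mult_strict_left_mono) auto
    also have "\<dots> = e" using K0 by (simp add: \<delta>_def field_simps)
    finally show ?thesis .
  qed
  show ?thesis by (rule bexI[OF _ L]) (simp add: N)
qed

lemma Lg_approx_UNIV:
  fixes b :: "nat \<Rightarrow> 'b"
  assumes Bass: "Bass_condition n A" and e: "0 < e"
  shows "\<exists>d \<in> Lg n UNIV. \<forall>i<n. norm (d i - b i) < e"
proof -
  have "\<forall>i. \<exists>x\<in>A. norm (x - b i) < e / 2"
    using dense e closure_approachable[of _ A] unfolding dist_norm by (metis UNIV_I half_gt_zero)
  then obtain b' where b': "\<And>i. b' i \<in> A" "\<And>i. norm (b' i - b i) < e / 2" by metis
  obtain d where d: "d \<in> Lg n UNIV" "\<And>i. i < n \<Longrightarrow> norm (d i - b' i) < e / 2"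
    using Lg_approx_subalgebra[OF Bass, of b' "e / 2"] b'(1) e by auto
  have "norm (d i - b i) < e" if "i < n" for i
    using norm_triangle_ineq[of "d i - b' i" "b' i - b i"] d(2)[OF that] b'(2)[of i] by simp
  then show ?thesis using d(1) by blast
qed

text \<open>Rieffel's argument: in a relation \<open>\<Sum> x\<^sub>i b\<^sub>i + x\<^sub>n b\<^sub>n = 1\<close>, the \<open>x\<^sub>i\<close> are perturbed so that they become
  right unimodular, \<open>\<Sum> x\<^sub>i y\<^sub>i = 1\<close>; then \<open>\<Sum> x\<^sub>i (b\<^sub>i + y\<^sub>i x\<^sub>n b\<^sub>n)\<close> is still close to \<open>1\<close>.\<close>

lemma Bass_condition_UNIV:
  assumes Bass: "Bass_condition n A"
  shows "Bass_condition n (UNIV :: 'b set)"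
  unfolding Bass_condition_def
proof
  fix b :: "nat \<Rightarrow> 'b" assume "b \<in> Lg (Suc n) UNIV"
  then obtain x where x: "(\<Sum>i<n. x i * b i) + x n * b n = 1" by (auto simp: Lg_UNIV_iff)
  \<comment> \<open>Density concerns left unimodular tuples, so it is applied to the stars; starring
    back gives right unimodular approximations of the \<open>x i\<close>.\<close>
  have "\<forall>k. \<exists>d \<in> Lg n UNIV. \<forall>i<n. norm (d i - star (x i)) < inverse (real (Suc k))"
    using Lg_approx_UNIV[OF Bass] by simp
  then obtain D where D: "\<And>k. D k \<in> Lg n (UNIV :: 'b set)"
    "\<And>k i. i < n \<Longrightarrow> norm (D k i - star (x i)) < inverse (real (Suc k))" by metis
  have lim: "(\<lambda>k. star (D k i)) \<longlonglongrightarrow> x i" if "i < n" for i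
  proof -
    have "(\<lambda>k. D k i - star (x i)) \<longlonglongrightarrow> 0"
      by (rule Lim_null_comparison[OF _ LIMSEQ_inverse_real_of_nat])
        (use D(2)[OF that] in \<open>auto intro!: always_eventually less_imp_le\<close>)
    then show ?thesis using tendsto_star[of "\<lambda>k. D k i" "star (x i)"] by (simp add: LIM_zero_iff)
  qed
  have "(\<lambda>k. (\<Sum>i<n. star (D k i) * b i) + x n * b n) \<longlonglongrightarrow> 1"
    unfolding x[symmetric] by (intro tendsto_add tendsto_sum tendsto_mult tendsto_const lim) auto
  then obtain k where k: "(\<Sum>i<n. star (D k i) * b i) + x n * b n \<in> invertibles UNIV"
    using eventually_invertible by blast
  obtain y where "(\<Sum>i<n. y i * D k i) = 1" using D(1)[of k] by (auto simp: Lg_UNIV_iff)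
  then have y: "(\<Sum>i<n. star (D k i) * star (y i)) = 1"
    by (metis (no_types, lifting) star_mult star_one star_sum sum.cong)
  \<comment> \<open>The starred relation collapses the added terms to \<open>x n * b n\<close>, so
    the new sum is exactly the one already known to be invertible.\<close>
  have "(\<Sum>i<n. star (D k i) * (b i + star (y i) * x n * b n))
      = (\<Sum>i<n. star (D k i) * b i) + (\<Sum>i<n. star (D k i) * star (y i)) * (x n * b n)"
    by (simp add: distrib_left sum.distrib sum_distrib_right mult.assoc)
  then have "(\<lambda>i. b i + star (y i) * x n * b n) \<in> Lg n UNIV"
    using k y by (intro Lg_UNIV_if_invertible[where x = "\<lambda>i. star (D k i)"]) simp
  then show "\<exists>c. (\<forall>i<n. c i \<in> UNIV) \<and> (\<lambda>i. b i + c i * b n) \<in> Lg n UNIV"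
    by (intro exI[of _ "\<lambda>i. star (y i) * x n"]) simp
qed

end

theorem theorem1p1:
  fixes A :: "'b::unital_cstar_algebra set" and T :: "'b topology"
  assumes "unital_star_subalgebra A"
    and "closure A = UNIV"
    and "full_subalgebra A"
    and "frechet_algebra_on A T"
    and "Q_algebra_on A T"
    and "closed_under_smooth_calculus A"
  shows "Bsr A = Bsr (UNIV :: 'b set)"
proof -
  interpret smooth_subalgebra A
    using assms by unfold_locales
  have "Bass_condition n A \<longleftrightarrow> Bass_condition n (UNIV :: 'b set)" for n
    using Bass_condition_subalgebra Bass_condition_UNIV by blast
  then show ?thesis unfolding Bsr_def Bass_condition_def by simp
qed

end
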